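(* Suppose $f\in\mathcal{O}^\ast$, $\alpha>1$ and \[ f^\alpha(z)=\sum_{i=1}^kc_i\frac{1}{(1-\overline{w_i}z)^\alpha},\quad z\in\mathbb{D}, \] with $w_1,\dots,w_k\in\mathbb{D}$. Suppose further that the set of points $\{w_1,\dots,w_k\}$ belongs to a single real line, and that $c_i\ge0$ for $i=1,\dots,k$. Then \[ \frac{\partial}{\partial\alpha}N_f(\alpha)\le0. \]
   Context: $\mathbb{D}$ is the open unit disc in $\mathbb{C}$. $\mathcal{O}^\ast$ is the set of functions $f$ holomorphic in some open neighborhood of $\overline{\mathbb{D}}$ with $f(z)\ne0$ for all $z\in\overline{\mathbb{D}}$. For $\alpha>1$, \[ N_f(\alpha)=\Big(\int_{\mathbb{D}}|f(z)|^{2\alpha}(\alpha-1)(1-|z|^2)^{\alpha-2}\,\frac{dx\,dy}{\pi}\Big)^{\frac{1}{2\alpha}}, \] and $\frac{\partial}{\partial\alpha}N_f(\alpha)$ is its derivative in $\alpha$ with $f$ fixed, evaluated at the given value of $\alpha$. Powers $(1-\overline{w}z)^\alpha$ use the principal branch. $f^\alpha$ denotes $e^{\alpha h}$, where $h$ is a holomorphic function on $\mathbb{D}$ with $f=e^h$. *)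

theory Defs
  imports "HOL-Complex_Analysis.Complex_Analysis"
begin

definition zero_free_hol :: "(complex \<Rightarrow> complex) set" where
  "zero_free_hol =
     {f. (\<exists>U. open U \<and> cball 0 1 \<subseteq> U \<and> f holomorphic_on U) \<and> (\<forall>z\<in>cball 0 1. f z \<noteq> 0)}"

(* lborel on complex is the planar Lebesgue measure dx dy.  The formula is only
   meant for a > 1. *)
definition bergman_N :: "(complex \<Rightarrow> complex) \<Rightarrow> real \<Rightarrow> real" where
  "bergman_N f a =
     (LINT z:ball 0 1|lborel.
        norm (f z) powr (2 * a) * (a - 1) * (1 - (norm z)\<^sup>2) powr (a - 2) / pi) powr (1 / (2 * a))"

(* A logarithm of f on the unit disc.  It is unique only up to a constant in
   2 pi i Z, so the power f^a = exp (a h) is determined by h, not by f alone. *)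
definition disc_log :: "(complex \<Rightarrow> complex) \<Rightarrow> (complex \<Rightarrow> complex) \<Rightarrow> bool" where
  "disc_log f h \<longleftrightarrow> h holomorphic_on ball 0 1 \<and> (\<forall>z\<in>ball 0 1. f z = exp (h z))"

end

theory Submission
  imports Defs
begin

text \<open>
  Put \<open>u z = \<bar>f z\<bar>\<^sup>2 (1 - \<bar>z\<bar>\<^sup>2)\<close>, let \<open>m\<close> be the maximum of \<open>ln u\<close> on the disc, let \<open>v = ln u - m \<le> 0\<close>
  and let \<open>dA = (1 - \<bar>z\<bar>\<^sup>2)\<^sup>-\<^sup>2 dx dy\<close> be the invariant area. Then
  \<open>N_f(\<beta>)\<close> is \<open>exp (m/2) * J(\<beta>) powr (1/(2\<beta>))\<close> with \<open>J(\<beta>) = (\<beta> - 1)/\<pi> * \<integral> exp (\<beta> v) dA\<close>, so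
  its derivative at \<open>\<alpha>\<close> has the sign of \<open>\<alpha> J' - J ln J\<close>. Since \<open>J ln J \<ge> J - 1\<close>, it suffices
  that \<open>\<alpha> J' \<le> J - 1\<close>. Written out, this is
  \<open>\<integral> \<phi>'(v) dA \<ge> \<integral> \<phi>(v) dA + \<pi> \<phi>(0)\<close> for \<open>\<phi> t = (1 - \<alpha> t) exp (\<alpha> t)\<close>, a function that is
  nondecreasing on the negative half-line (lemma \<open>entropy_inequality\<close>).

  The last inequality holds for all nonnegative nondecreasing \<open>\<phi>\<close> that vanish at \<open>-\<infinity>\<close>. It is the
  integrated form of Kulikov's theorem that \<open>t (1 + \<mu>(t))\<close> is nonincreasing, where \<open>\<pi> \<mu>(t)\<close> is the
  invariant area of \<open>{u > t}\<close>. Two facts produce it. First, \<open>f\<close> has a logarithm on the disc,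
  hence \<open>ln \<bar>f\<bar>\<close> is harmonic and \<open>v\<close> has constant invariant Laplacian; by the divergence theorem
  \<open>\<integral> g(v) \<bar>\<nabla>v\<bar>\<^sup>2 dA = \<integral> G(v) dA\<close> whenever \<open>G' = g\<close> and \<open>G\<close> vanishes on low
  levels (in the metric of curvature \<open>-1\<close>).
  Second, the superlevel sets of \<open>v\<close> satisfy the isoperimetric inequality of the hyperbolic plane.
  The usual route goes through level curves, the coarea formula and the Cauchy-Schwarz inequality. Here the two facts
  are combined in one pointwise estimate, which needs no regularity or topology of level sets:
  for a field \<open>n\<close> of unit vectors and a constant \<open>k > 0\<close>,
  \<open>1 \<ge> 2 k (n \<bullet> \<nabla>v) - k\<^sup>2 \<bar>\<nabla>v\<bar>\<^sup>2\<close>.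

  The field comes from E. Schmidt's proof of the isoperimetric inequality. In the coordinates
  \<open>x + i exp e\<close> of the upper half-plane, the translations in \<open>x\<close> are isometries. Let the superlevel set
  project onto a set of total length \<open>2 R\<close> of the \<open>e\<close>-axis. Slide the pieces of this set together and
  compare with the hyperbolic disc of radius \<open>R\<close>: take for \<open>n\<close>, at each
  point of the projection, the normal of that disc at the corresponding height. The \<open>e\<close>-component of the estimate
  is then an exact divergence, and the \<open>x\<close>-component only uses that on every horizontal
  line that meets the superlevel set, \<open>v\<close> has to rise above the level and to fall below it again.
  With \<open>k = coth (R/2)\<close> all constants fit together (lemma \<open>slab_inequality\<close>). As \<open>R\<close> depends on the level,
  this is used on thin slabs of levels, whose errors telescope
  (lemma \<open>superlevel_inequality\<close>).
\<close>

section \<open>The horizontal width of a hyperbolic disc\<close>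

text \<open>
  A Euclidean circle with centre \<open>i cosh R\<close> and radius \<open>sinh R\<close> is a hyperbolic circle of radius \<open>R\<close> about
  \<open>i\<close>. The integrand is the horizontal component of its unit normal at height \<open>exp (t - R)\<close>, and the integral is the
  contribution of the horizontal component to the isoperimetric constant.
\<close>

lemma integral_disc_width:
  fixes R :: real
  assumes "R > 0"
  shows "integral {0..2*R} (\<lambda>t. sqrt (1 - ((exp (t - R) - cosh R) / sinh R)\<^sup>2))
           = pi * (cosh R - 1) / sinh R"
proof -
  define C S where "C = cosh R" and "S = sinh R"
  have S: "S > 0" unfolding S_def using assms by simp
  have CS: "C\<^sup>2 = S\<^sup>2 + 1" unfolding C_def S_def using cosh_square_eq by blast
  have e1: "exp R = C + S" and e2: "exp (-R) = C - S"
    unfolding C_def S_def by (simp_all add: cosh_plus_sinh cosh_minus_sinh)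
  have C1: "C > 0" unfolding C_def by simp
  have prod: "(C + S) * (C - S) = 1" using CS by (simp add: power2_eq_square algebra_simps)
  define X where "X = (\<lambda>y. 2 * C * y - y\<^sup>2 - 1)"
  \<comment> \<open>in the height \<open>y\<close> the integrand is \<open>sqrt (X y) / (S y)\<close>, which has an elementary antiderivative\<close>
  define F where "F = (\<lambda>t. (sqrt (X (exp (t - R))) + C * arcsin ((exp (t - R) - C) / S)
        - arcsin ((C * exp (t - R) - 1) / (S * exp (t - R)))) / S)"
  have X1: "X y = S\<^sup>2 - (y - C)\<^sup>2" for y unfolding X_def using CS by (simp add: power2_eq_square algebra_simps)
  have X2: "X y = (S * y)\<^sup>2 - (C * y - 1)\<^sup>2" for y
  proof -
    have "(S*y)\<^sup>2 - (C*y-1)\<^sup>2 = (S\<^sup>2 - C\<^sup>2) * y\<^sup>2 + 2*C*y - 1" by (simp add: power2_eq_square algebra_simps)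
    then show ?thesis unfolding X_def using CS by simp
  qed
  have sq: "sqrt (1 - ((y - C) / S)\<^sup>2) = sqrt (X y) / S" for y
  proof -
    have "1 - ((y - C) / S)\<^sup>2 = X y / S\<^sup>2" using S by (simp add: X1 power_divide field_simps)
    then show ?thesis using S by (simp add: real_sqrt_divide)
  qed
  have range: "C - S \<le> exp (t - R) \<and> exp (t - R) \<le> C + S" if "t \<in> {0..2*R}" for t
    using that e1 e2 exp_le_cancel_iff[of "-R" "t-R"] exp_le_cancel_iff[of "t-R" R] by simp
  have range': "C - S < exp (t - R) \<and> exp (t - R) < C + S" if "t \<in> {0<..<2*R}" for t
    using that e1 e2 exp_less_cancel_iff[of "-R" "t-R"] exp_less_cancel_iff[of "t-R" R] by simp
  have Xpos: "X y > 0" if "C - S < y" "y < C + S" for y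
  proof -
    have "\<bar>y - C\<bar> < S" using that by linarith
    then have "(y - C)\<^sup>2 < S\<^sup>2" using S by (metis abs_of_pos power2_abs power_strict_mono abs_ge_zero zero_less_numeral)
    then show ?thesis by (simp add: X1)
  qed
  have Xnn: "X y \<ge> 0" if "C - S \<le> y" "y \<le> C + S" for y
  proof -
    have "\<bar>y - C\<bar> \<le> S" using that by linarith
    then have "(y - C)\<^sup>2 \<le> S\<^sup>2" using S by (metis abs_of_pos power2_abs power_mono abs_ge_zero)
    then show ?thesis by (simp add: X1)
  qed
  have second: "\<bar>(C * y - 1) / (S * y)\<bar> \<le> 1" if "C - S \<le> y" "y \<le> C + S" "y > 0" for y
  proof -
    have "(C*y-1)\<^sup>2 \<le> (S*y)\<^sup>2" using Xnn[OF that(1,2)] by (simp add: X2)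
    then have "\<bar>C*y-1\<bar> \<le> S*y" using S that by (metis abs_le_square_iff abs_of_pos mult_pos_pos)
    then show ?thesis using S that by (simp add: abs_mult)
  qed
  have second': "\<bar>(C * y - 1) / (S * y)\<bar> < 1" if "C - S < y" "y < C + S" "y > 0" for y
  proof -
    have "(C*y-1)\<^sup>2 < (S*y)\<^sup>2" using Xpos[OF that(1,2)] by (simp add: X2)
    then have "\<bar>C*y-1\<bar> < S*y" using S that by (metis abs_of_pos mult_pos_pos power2_abs power_less_imp_less_base less_imp_le)
    then show ?thesis using S that by (simp add: abs_mult)
  qed
  have cont: "continuous_on {0..2*R} F"
  proof -
    have c1: "continuous_on {0..2*R} (\<lambda>t. arcsin ((exp (t - R) - C) / S))"
      by (rule continuous_on_arcsin) (use S range in \<open>auto intro!: continuous_intros simp: field_simps\<close>)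
    have c2: "continuous_on {0..2*R} (\<lambda>t. arcsin ((C * exp (t - R) - 1) / (S * exp (t - R))))"
    proof (rule continuous_on_arcsin)
      show "continuous_on {0..2 * R} (\<lambda>t. (C * exp (t - R) - 1) / (S * exp (t - R)))"
        using S by (auto intro!: continuous_intros)
      show "\<forall>t\<in>{0..2 * R}. - 1 \<le> (C * exp (t - R) - 1) / (S * exp (t - R)) \<and>
              (C * exp (t - R) - 1) / (S * exp (t - R)) \<le> 1"
        using second range by (metis abs_le_iff exp_gt_zero minus_le_iff)
    qed
    have c3: "continuous_on {0..2*R} (\<lambda>t. sqrt (X (exp (t - R))))"
      unfolding X_def by (intro continuous_intros)
    show ?thesis unfolding F_def
      by (intro continuous_on_divide continuous_on_diff continuous_on_add continuous_on_mult continuous_on_const c1 c2 c3)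
         (use S in auto)
  qed
  have der: "(F has_vector_derivative sqrt (1 - ((exp (t - R) - C) / S)\<^sup>2)) (at t)"
    if t: "t \<in> {0<..<2*R}" for t
  proof -
    define y where "y = exp (t - R)"
    have y: "C - S < y" "y < C + S" "y > 0" using range'[OF t] unfolding y_def by auto
    have Xp: "X y > 0" using Xpos y by blast
    have dX: "((\<lambda>t. sqrt (X (exp (t - R)))) has_real_derivative (C - y) * y / sqrt (X y)) (at t)"
    proof -
      have d: "((\<lambda>t. X (exp (t - R))) has_real_derivative 2 * ((C - y) * y)) (at t)"
        unfolding X_def by (auto intro!: derivative_eq_intros simp: y_def power2_eq_square algebra_simps)
      have "X (exp (t - R)) > 0" using Xp by (simp add: y_def)
      have e: "inverse (sqrt (X y)) / 2 * (2 * ((C - y) * y)) = (C - y) * y / sqrt (X y)"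
        by (simp add: inverse_eq_divide)
      have "((\<lambda>t. sqrt (X (exp (t - R)))) has_real_derivative
          inverse (sqrt (X (exp (t - R)))) / 2 * (2 * ((C - y) * y))) (at t)"
        by (rule DERIV_chain2[OF DERIV_real_sqrt d]) fact
      then show ?thesis unfolding y_def[symmetric] e .
    qed
    have s1: "sqrt (1 - ((y - C) / S)\<^sup>2) = sqrt (X y) / S" by (rule sq)
    have dA: "((\<lambda>t. arcsin ((exp (t - R) - C) / S)) has_real_derivative y / sqrt (X y)) (at t)"
    proof -
      have "\<bar>(y - C) / S\<bar> < 1" using y S by (simp add: abs_less_iff field_simps)
      then have "(arcsin has_real_derivative inverse (sqrt (1 - ((y - C) / S)\<^sup>2))) (at ((y - C)/S))"
        by (intro DERIV_arcsin) linarith+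
      moreover have "((\<lambda>t. (exp (t - R) - C) / S) has_real_derivative y / S) (at t)"
        using S by (auto intro!: derivative_eq_intros simp: y_def)
      ultimately have "((\<lambda>t. arcsin ((exp (t - R) - C) / S)) has_real_derivative
          inverse (sqrt (1 - ((y - C) / S)\<^sup>2)) * (y / S)) (at t)"
        unfolding y_def by (rule DERIV_chain2)
      moreover have "inverse (sqrt (X y) / S) * (y / S) = y / sqrt (X y)"
        using S by (simp add: inverse_eq_divide)
      ultimately show ?thesis unfolding s1 by simp
    qed
    have dB: "((\<lambda>t. arcsin ((C * exp (t - R) - 1) / (S * exp (t - R)))) has_real_derivative 1 / sqrt (X y)) (at t)"
    proof -
      have lt: "\<bar>(C * y - 1) / (S * y)\<bar> < 1" using second' y by blast
      then have "(arcsin has_real_derivative inverse (sqrt (1 - ((C * y - 1) / (S * y))\<^sup>2))) (at ((C * y - 1) / (S * y)))"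
        by (intro DERIV_arcsin) linarith+
      moreover have "((\<lambda>t. (C * exp (t - R) - 1) / (S * exp (t - R))) has_real_derivative 1 / (S * y)) (at t)"
      proof -
        have n: "S * exp (t - R) \<noteq> 0" using S by simp
        have "((\<lambda>t. (C * exp (t - R) - 1) / (S * exp (t - R))) has_real_derivative
           ((C * exp (t - R)) * (S * exp (t - R)) - (C * exp (t - R) - 1) * (S * exp (t - R)))
             / ((S * exp (t - R)) * (S * exp (t - R)))) (at t)"
          by (rule DERIV_divide) (use n in \<open>auto intro!: derivative_eq_intros\<close>)
        moreover have "((C * y) * (S * y) - (C * y - 1) * (S * y)) / ((S * y) * (S * y)) = 1 / (S * y)"
          using S y by (simp add: field_simps)
        ultimately show ?thesis by (simp add: y_def)
      qed
      ultimately have "((\<lambda>t. arcsin ((C * exp (t - R) - 1) / (S * exp (t - R)))) has_real_derivative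
          inverse (sqrt (1 - ((C * y - 1) / (S * y))\<^sup>2)) * (1 / (S * y))) (at t)"
        unfolding y_def by (rule DERIV_chain2)
      moreover have "1 - ((C * y - 1) / (S * y))\<^sup>2 = X y / (S * y)\<^sup>2"
        using S y by (simp add: X2 power_divide field_simps)
      then have s2: "sqrt (1 - ((C * y - 1) / (S * y))\<^sup>2) = sqrt (X y) / (S * y)"
        using S y by (simp add: real_sqrt_divide)
      moreover have "inverse (sqrt (X y) / (S * y)) * (1 / (S * y)) = 1 / sqrt (X y)"
        using S y by (simp add: inverse_eq_divide)
      ultimately show ?thesis by simp
    qed
    have "(F has_real_derivative ((C - y) * y / sqrt (X y) + C * (y / sqrt (X y)) - 1 / sqrt (X y)) / S) (at t)"
      unfolding F_def by (intro DERIV_cdivide DERIV_diff DERIV_add DERIV_cmult dX dA dB)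
    moreover have "((C - y) * y / sqrt (X y) + C * (y / sqrt (X y)) - 1 / sqrt (X y)) / S = sqrt (X y) / S"
    proof -
      have "(C - y) * y / sqrt (X y) + C * (y / sqrt (X y)) - 1 / sqrt (X y) = X y / sqrt (X y)"
        unfolding times_divide_eq_right add_divide_distrib[symmetric] diff_divide_distrib[symmetric]
        by (rule arg_cong[of _ _ "\<lambda>a. a / sqrt (X y)"]) (simp add: X_def power2_eq_square algebra_simps)
      also have "\<dots> = sqrt (X y)" using Xp by (simp add: real_div_sqrt)
      finally show ?thesis by simp
    qed
    ultimately have "(F has_real_derivative sqrt (X y) / S) (at t)" by (simp only:)
    then show ?thesis unfolding sq y_def has_real_derivative_iff_has_vector_derivative .
  qed
  have "((\<lambda>t. sqrt (1 - ((exp (t - R) - C) / S)\<^sup>2)) has_integral F (2*R) - F 0) {0..2*R}"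
    by (rule fundamental_theorem_of_calculus_interior) (use assms cont der in auto)
  moreover have Fr: "F (2*R) = (C * pi/2 - pi/2) / S"
  proof -
    have "(C * (C+S) - 1) = S * (C+S)" using CS by (simp add: field_simps power2_eq_square)
    then have q: "(C * (C+S) - 1) / (S * (C+S)) = 1" using S C1 by simp
    have x: "X (C+S) = 0" by (simp add: X1)
    have "2 * R - R = R" by simp
    then have "F (2*R) = (sqrt (X (C+S)) + C * arcsin ((C+S-C) / S) - arcsin ((C * (C+S) - 1) / (S * (C+S)))) / S"
      unfolding F_def by (simp only: e1)
    then show ?thesis unfolding q x using S by simp
  qed
  moreover have Fl: "F 0 = (- C * pi/2 + pi/2) / S"
  proof -
    have pos: "C - S > 0" using e2 by (metis exp_gt_zero)
    have "(C * (C-S) - 1) = - (S * (C-S))" using CS by (simp add: field_simps power2_eq_square)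
    then have q: "(C * (C-S) - 1) / (S * (C-S)) = -1" using S pos by simp
    have x: "X (C-S) = 0" by (simp add: X1)
    have "0 - R = - R" by simp
    then have "F 0 = (sqrt (X (C-S)) + C * arcsin ((C-S-C) / S) - arcsin ((C * (C-S) - 1) / (S * (C-S)))) / S"
      unfolding F_def by (simp only: e2)
    then show ?thesis unfolding q x using S by simp
  qed
  moreover have "F (2*R) - F 0 = pi * (C - 1) / S"
    unfolding Fr Fl diff_divide_distrib[symmetric]
    by (rule arg_cong[of _ _ "\<lambda>a. a / S"]) (simp add: field_simps)
  ultimately have "((\<lambda>t. sqrt (1 - ((exp (t - R) - C) / S)\<^sup>2)) has_integral pi * (C - 1) / S) {0..2*R}"
    by (simp only:)
  then show ?thesis unfolding C_def S_def by (simp add: integral_unique)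
qed

section \<open>Integrals over squares\<close>

text \<open>
  All integrands below are continuous and vanish outside a bounded set that is known in advance, so
  integrals over one large square suffice. The variables are called \<open>x\<close> and \<open>e\<close>: the second
  one is the logarithm of the height in the upper half-plane.
\<close>

definition plane_int :: "real \<Rightarrow> (real \<Rightarrow> real \<Rightarrow> real) \<Rightarrow> real" where
  "plane_int a F = integral (cbox (-a, -a) (a, a)) (\<lambda>p. F (fst p) (snd p))"

abbreviation cont2 :: "(real \<Rightarrow> real \<Rightarrow> real) \<Rightarrow> bool" where
  "cont2 F \<equiv> continuous_on UNIV (\<lambda>p. F (fst p) (snd p))"

lemma cont2_integrable: "cont2 F \<Longrightarrow> (\<lambda>p. F (fst p) (snd p)) integrable_on cbox (-a, -a) (a, a)"
  by (rule integrable_continuous) (rule continuous_on_subset, auto)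

lemma cont2_slice1:
  assumes "cont2 F"
  shows "continuous_on A (\<lambda>x. F x e)"
proof -
  have "continuous_on A (\<lambda>x. (x, e))" by (intro continuous_intros)
  from continuous_on_compose2[OF assms this] show ?thesis by simp
qed

lemma plane_int_add: "cont2 F \<Longrightarrow> cont2 G \<Longrightarrow> plane_int a (\<lambda>x e. F x e + G x e) = plane_int a F + plane_int a G"
  unfolding plane_int_def by (rule integral_add) (auto intro: cont2_integrable)

lemma plane_int_diff: "cont2 F \<Longrightarrow> cont2 G \<Longrightarrow> plane_int a (\<lambda>x e. F x e - G x e) = plane_int a F - plane_int a G"
  unfolding plane_int_def by (rule integral_diff) (auto intro: cont2_integrable)

lemma plane_int_cmult: "plane_int a (\<lambda>x e. c * F x e) = c * plane_int a F"
  unfolding plane_int_def by simp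

lemma plane_int_sum:
  assumes "finite J" "\<And>j. j \<in> J \<Longrightarrow> cont2 (F j)"
  shows "plane_int a (\<lambda>x e. \<Sum>j\<in>J. F j x e) = (\<Sum>j\<in>J. plane_int a (F j))"
  unfolding plane_int_def by (rule integral_sum) (use assms in \<open>auto intro: cont2_integrable\<close>)

lemma plane_int_mono:
  assumes "cont2 F" "cont2 G" "\<And>x e. \<lbrakk>\<bar>x\<bar> \<le> a; \<bar>e\<bar> \<le> a\<rbrakk> \<Longrightarrow> F x e \<le> G x e"
  shows "plane_int a F \<le> plane_int a G"
  unfolding plane_int_def
  by (rule integral_le) (use assms in \<open>auto intro!: cont2_integrable simp: abs_le_iff\<close>)

lemma plane_int_cong:
  assumes "\<And>x e. \<lbrakk>\<bar>x\<bar> \<le> a; \<bar>e\<bar> \<le> a\<rbrakk> \<Longrightarrow> F x e = G x e"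
  shows "plane_int a F = plane_int a G"
  unfolding plane_int_def
  by (rule integral_cong) (use assms in \<open>auto simp: abs_le_iff\<close>)

lemma plane_int_iter_xe:
  assumes "cont2 F"
  shows "plane_int a F = integral {-a..a} (\<lambda>x. integral {-a..a} (\<lambda>e. F x e))"
  unfolding plane_int_def
  using integral_prod_continuous[of "-a" "-a" a a "\<lambda>p. F (fst p) (snd p)"]
    continuous_on_subset[OF assms, of "cbox (-a, -a) (a, a)"]
  by simp

lemma plane_int_iter_ex:
  assumes "cont2 F"
  shows "plane_int a F = integral {-a..a} (\<lambda>e. integral {-a..a} (\<lambda>x. F x e))"
proof -
  have "continuous_on (cbox (-a,-a) (a,a)) (\<lambda>(x,e). F x e)"
    using continuous_on_subset[OF assms] by (simp add: case_prod_unfold)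
  from integral_swap_continuous[OF this] plane_int_iter_xe[OF assms, of a] show ?thesis by simp
qed

lemma plane_int_deriv_x:
  assumes "a > 0" and "cont2 F'"
    and "\<And>x e. ((\<lambda>x. F x e) has_real_derivative F' x e) (at x)"
    and "\<And>x e. \<bar>x\<bar> \<ge> a \<or> \<bar>e\<bar> \<ge> a \<Longrightarrow> F x e = 0"
  shows "plane_int a F' = 0"
proof -
  have "integral {-a..a} (\<lambda>x. F' x e) = 0" for e
  proof -
    have "((\<lambda>x. F' x e) has_integral F a e - F (-a) e) {-a..a}"
      by (rule fundamental_theorem_of_calculus)
         (use assms in \<open>auto simp: has_real_derivative_iff_has_vector_derivative[symmetric]
            intro: has_field_derivative_at_within\<close>)
    moreover have "F a e = 0" "F (-a) e = 0" using assms(1,4) by auto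
    ultimately show ?thesis by (simp add: integral_unique)
  qed
  then show ?thesis by (simp add: plane_int_iter_ex[OF assms(2)])
qed

lemma plane_int_deriv_e:
  assumes "a > 0" and "cont2 F'"
    and "\<And>x e. ((\<lambda>e. F x e) has_real_derivative F' x e) (at e)"
    and "\<And>x e. \<bar>x\<bar> \<ge> a \<or> \<bar>e\<bar> \<ge> a \<Longrightarrow> F x e = 0"
  shows "plane_int a F' = 0"
proof -
  have "integral {-a..a} (\<lambda>e. F' x e) = 0" for x
  proof -
    have "((\<lambda>e. F' x e) has_integral F x a - F x (-a)) {-a..a}"
      by (rule fundamental_theorem_of_calculus)
         (use assms in \<open>auto simp: has_real_derivative_iff_has_vector_derivative[symmetric]
            intro: has_field_derivative_at_within\<close>)
    moreover have "F x a = 0" "F x (-a) = 0" using assms(1,4) by auto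
    ultimately show ?thesis by (simp add: integral_unique)
  qed
  then show ?thesis by (simp add: plane_int_iter_xe[OF assms(2)])
qed

lemma antiderivative_real:
  fixes f :: "real \<Rightarrow> real"
  assumes "continuous_on UNIV f"
  obtains F where "\<And>x. (F has_real_derivative f x) (at x)"
proof -
  have "\<exists>F. \<forall>x. -\<infinity> < ereal x \<longrightarrow> ereal x < \<infinity> \<longrightarrow> (F has_vector_derivative f x) (at x)"
    using assms by (intro einterval_antiderivative) (auto simp: continuous_on_eq_continuous_at)
  then show ?thesis using that by (auto simp: has_real_derivative_iff_has_vector_derivative)
qed

lemma FTC_real:
  fixes F :: "real \<Rightarrow> real"
  assumes "\<And>x. (F has_real_derivative f x) (at x)" "a \<le> b"
  shows "(f has_integral F b - F a) {a..b}"
  by (rule fundamental_theorem_of_calculus)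
     (use assms in \<open>auto simp: has_real_derivative_iff_has_vector_derivative[symmetric]
            intro: has_field_derivative_at_within\<close>)

section \<open>The isoperimetric argument in the half-plane\<close>

text \<open>
  The plane with the metric \<open>exp (-2 e) dx\<^sup>2 + de\<^sup>2\<close> is the hyperbolic plane of curvature \<open>-1\<close>: it is
  the upper half-plane in the coordinates \<open>x + i exp e\<close>, with area form \<open>exp (-e) dx de\<close>. The equation \<open>pde\<close>
  says that the hyperbolic Laplacian of \<open>V\<close> is \<open>-1\<close>.
\<close>

locale torsion_plane =
  fixes V Vx Ve Vxx Vee :: "real \<Rightarrow> real \<Rightarrow> real"
  assumes V_x: "\<And>x e. ((\<lambda>x. V x e) has_real_derivative Vx x e) (at x)"
    and V_e: "\<And>x e. ((\<lambda>e. V x e) has_real_derivative Ve x e) (at e)"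
    and V_xx: "\<And>x e. ((\<lambda>x. Vx x e) has_real_derivative Vxx x e) (at x)"
    and V_ee: "\<And>x e. ((\<lambda>e. Ve x e) has_real_derivative Vee x e) (at e)"
    and cont_V: "cont2 V" "cont2 Vx" "cont2 Ve" "cont2 Vxx" "cont2 Vee"
    and pde: "\<And>x e. exp (2 * e) * Vxx x e + Vee x e - Ve x e = -1"
    and proper: "\<And>s. \<exists>a>0. \<forall>x e. s \<le> V x e \<longrightarrow> \<bar>x\<bar> < a \<and> \<bar>e\<bar> < a"
begin

text \<open>
  The isoperimetric argument for the levels between \<open>c\<close> and \<open>d\<close>, where \<open>g\<close> is a weight on
  levels and \<open>G\<close> its antiderivative. The cutoff \<open>X\<close> is a continuous majorant of the indicator of the projection of \<open>{c \<le> V}\<close>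
  to the \<open>e\<close>-axis, and \<open>X'\<close> a minorant of that of \<open>{d \<le> V}\<close>. If both had
  the same integral, the error term would disappear.

  The function \<open>s\<close> in the proof slides the projection together to the interval \<open>{0..2 * R}\<close>, \<open>(aw (s e), b e)\<close> are the components of the
  unit normal of the disc of radius \<open>R\<close>, and integrating
  \<open>1 \<ge> 2 (N p - k b q) - k\<^sup>2 (p\<^sup>2 + q\<^sup>2)\<close>
  with \<open>p = exp e * \<bar>Vx\<bar>\<close> and \<open>q = Ve\<close> gives the result. The choice \<open>k = coth (R/2)\<close> makes
  the coefficient \<open>2 k coth R - k\<^sup>2\<close> of the area equal to 1 and the constant term equal to \<open>4 \<pi>\<close>.
\<close>

lemma slab_inequality:
  assumes g: "continuous_on UNIV g" "\<And>t. g t \<ge> 0"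
    and G: "\<And>t. (G has_real_derivative g t) (at t)"
    and Gc: "\<And>t. t \<le> c \<Longrightarrow> G t = 0" and Gd: "\<And>t. d \<le> t \<Longrightarrow> G t = G d" and cd: "c \<le> d"
    and a: "a > 0" "\<And>x e. c \<le> V x e \<Longrightarrow> \<bar>x\<bar> < a \<and> \<bar>e\<bar> < a"
    and X: "continuous_on UNIV X" "\<And>e. X e \<le> 1" "\<And>x e. c \<le> V x e \<Longrightarrow> X e = 1"
    and X': "continuous_on UNIV X'" "\<And>e. 0 \<le> X' e" "\<And>e. X' e \<le> X e"
       "\<And>e. X' e > 0 \<Longrightarrow> \<exists>x. d \<le> V x e"
    and lam: "lam = integral {-a..a} X" "lam > 0" "lam' = integral {-a..a} X'"
  shows "plane_int a (\<lambda>x e. g (V x e) * exp (-e)) \<ge>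
     plane_int a (\<lambda>x e. G (V x e) * exp (-e)) + G d * (4 * pi - 4 * ((cosh (lam/2) + 1) / sinh (lam/2)) * (lam - lam'))"
proof -
  define R C S where "R = lam/2" and "C = cosh R" and "S = sinh R"
  have R: "R > 0" using lam by (simp add: R_def)
  have S: "S > 0" unfolding S_def using R by simp
  have CS: "C\<^sup>2 = S\<^sup>2 + 1" unfolding C_def S_def using cosh_square_eq by blast
  have C1: "C \<ge> 1" unfolding C_def by (rule cosh_real_ge_1)
  have e1: "exp R = C + S" and e2: "exp (-R) = C - S"
    unfolding C_def S_def by (simp_all add: cosh_plus_sinh cosh_minus_sinh)
  define k where "k = (C + 1) / S"
  have k: "k > 0" unfolding k_def using S C1 by simp
  have k1: "2 * k * (C / S) - k\<^sup>2 = 1"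
  proof -
    have "2 * k * (C / S) - k\<^sup>2 = (2 * (C + 1) * C - (C + 1)\<^sup>2) / S\<^sup>2"
      unfolding k_def power_divide by (simp add: diff_divide_distrib power2_eq_square)
    also have "2 * (C + 1) * C - (C + 1)\<^sup>2 = S\<^sup>2"
      using CS by (simp add: power2_eq_square algebra_simps)
    also have "S\<^sup>2 / S\<^sup>2 = 1" using S by simp
    finally show ?thesis .
  qed
  have k2: "k * ((C - 1) / S) = 1"
  proof -
    have "k * ((C - 1) / S) = ((C + 1) * (C - 1)) / S\<^sup>2"
      unfolding k_def by (simp add: power2_eq_square)
    also have "(C + 1) * (C - 1) = S\<^sup>2"
      using CS by (simp add: power2_eq_square algebra_simps)
    also have "S\<^sup>2 / S\<^sup>2 = 1" using S by simp
    finally show ?thesis .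
  qed
  have X0: "0 \<le> X e" for e using X'(2,3) order_trans by blast
  obtain s0 where s0: "\<And>e. (s0 has_real_derivative X e) (at e)" using antiderivative_real[OF X(1)] by blast
  define s where "s = (\<lambda>e. s0 e - s0 (-a))"
  have s: "(s has_real_derivative X e) (at e)" for e
    unfolding s_def using s0 by (auto intro!: derivative_eq_intros)
  have s_a: "s (-a) = 0" "s a = 2 * R"
    using integral_unique[OF FTC_real[OF s0, of "-a" a]] a(1) lam(1) by (auto simp: s_def R_def)
  have s_mono: "s u \<le> s v" if "u \<le> v" for u v
    by (rule DERIV_nonneg_imp_nondecreasing[OF that]) (use s X0 in blast)
  have s_range: "0 \<le> s e \<and> s e \<le> 2 * R" if "\<bar>e\<bar> \<le> a" for e
    using s_mono[of "-a" e] s_mono[of e a] that s_a by auto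
  have s_cont: "continuous_on UNIV s"
    using s by (meson DERIV_isCont continuous_at_imp_continuous_on)
  define aw where "aw = (\<lambda>t. sqrt (1 - ((exp (t - R) - C) / S)\<^sup>2))"
  have aw_cont: "continuous_on UNIV aw" unfolding aw_def using S by (auto intro!: continuous_intros)
  define b where "b = (\<lambda>e. (exp (s e - R) - C) / S)"
  define N where "N = (\<lambda>e. k * aw (s e))"
  have b_cont: "continuous_on UNIV b" unfolding b_def using S s_cont by (auto intro!: continuous_intros)
  have N_cont: "continuous_on UNIV N" unfolding N_def
    by (intro continuous_intros continuous_on_compose2[OF aw_cont] s_cont) auto
  have b_le: "(b e)\<^sup>2 \<le> 1" if "\<bar>e\<bar> \<le> a" for e
  proof -
    have "exp (-R) \<le> exp (s e - R)" "exp (s e - R) \<le> exp R" using s_range[OF that] by auto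
    then have "\<bar>b e\<bar> \<le> 1" unfolding b_def e1 e2 using S by (auto simp: abs_le_iff field_simps)
    then show ?thesis by (simp add: abs_square_le_1)
  qed
  have N_eq: "N e = k * sqrt (1 - (b e)\<^sup>2)" for e unfolding N_def aw_def b_def ..
  have N0: "0 \<le> N e" if "\<bar>e\<bar> \<le> a" for e unfolding N_eq using k b_le[OF that] by simp
  have Nk: "N e \<le> k" for e unfolding N_eq using k by (simp add: mult_le_cancel_left1)
  have Nb: "(N e)\<^sup>2 + (k * b e)\<^sup>2 = k\<^sup>2" if "\<bar>e\<bar> \<le> a" for e
    unfolding N_eq using b_le[OF that] by (simp add: power_mult_distrib algebra_simps)
  have G_cont: "continuous_on UNIV G"
    using G by (meson DERIV_isCont continuous_at_imp_continuous_on)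
  have G0: "0 \<le> G t" for t
  proof (cases "t \<le> c")
    case False
    then have "G c \<le> G t" by (intro DERIV_nonneg_imp_nondecreasing[of c t G]) (use G g in auto)
    then show ?thesis using Gc[of c] by simp
  qed (simp add: Gc)
  have cs: "continuous_on UNIV (\<lambda>p::real\<times>real. h (snd p))" if "continuous_on UNIV h" for h :: "real \<Rightarrow> real"
    by (rule continuous_on_compose2[OF that]) (auto intro!: continuous_intros)
  have cV: "continuous_on UNIV (\<lambda>p. h (V (fst p) (snd p)))" if "continuous_on UNIV h" for h :: "real \<Rightarrow> real"
    by (rule continuous_on_compose2[OF that cont_V(1)]) auto
  note ci = continuous_intros cont_V cV[OF g(1)] cV[OF G_cont] cs[OF b_cont] cs[OF N_cont] cs[OF X(1)] cs[OF s_cont]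
  have GV0: "G (V x e) = 0" if "\<bar>x\<bar> \<ge> a \<or> \<bar>e\<bar> \<ge> a" for x e
  proof (rule Gc)
    show "V x e \<le> c" using a(2)[of x e] that by linarith
  qed
  have dGx: "((\<lambda>x. G (V x e)) has_real_derivative g (V x e) * Vx x e) (at x)" for x e
    by (rule DERIV_chain2[OF G V_x])
  have dGe: "((\<lambda>e. G (V x e)) has_real_derivative g (V x e) * Ve x e) (at e)" for x e
    by (rule DERIV_chain2[OF G V_e])
  let ?I = "plane_int a"
  define A where "A = ?I (\<lambda>x e. G (V x e) * exp (-e))"
  \<comment> \<open>divergence theorem for \<open>G(V) \<nabla>V\<close> and the equation for the Laplacian\<close>
  have i: "?I (\<lambda>x e. g (V x e) * (exp e * (Vx x e)\<^sup>2 + exp (-e) * (Ve x e)\<^sup>2)) = A"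
  proof -
    define F1 F2 where "F1 = (\<lambda>x e. g (V x e) * Vx x e * (exp e * Vx x e) + G (V x e) * (exp e * Vxx x e))"
      and "F2 = (\<lambda>x e. g (V x e) * Ve x e * (exp (-e) * Ve x e) + G (V x e) * (exp (-e) * Vee x e - exp (-e) * Ve x e))"
    have c1: "cont2 F1" unfolding F1_def by (intro ci)
    have c2: "cont2 F2" unfolding F2_def by (intro ci)
    have "?I F1 = 0"
    proof (rule plane_int_deriv_x[OF a(1) c1])
      show "((\<lambda>x. G (V x e) * (exp e * Vx x e)) has_real_derivative F1 x e) (at x)" for x e
        unfolding F1_def by (rule derivative_eq_intros dGx V_xx refl)+ simp
    qed (simp add: GV0)
    moreover have "?I F2 = 0"
    proof (rule plane_int_deriv_e[OF a(1) c2])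
      show "((\<lambda>e. G (V x e) * (exp (-e) * Ve x e)) has_real_derivative F2 x e) (at e)" for x e
        unfolding F2_def by (rule derivative_eq_intros dGe V_ee refl)+ (simp add: algebra_simps)
    qed (simp add: GV0)
    ultimately have "0 = ?I (\<lambda>x e. F1 x e + F2 x e)" using plane_int_add[OF c1 c2] by simp
    also have "\<dots> = ?I (\<lambda>x e. g (V x e) * (exp e * (Vx x e)\<^sup>2 + exp (-e) * (Ve x e)\<^sup>2) - G (V x e) * exp (-e))"
    proof (rule plane_int_cong)
      fix x e
      have "exp e * Vxx x e + exp (-e) * Vee x e - exp (-e) * Ve x e
          = exp (-e) * (exp (2 * e) * Vxx x e + Vee x e - Ve x e)"
        by (simp add: algebra_simps exp_add[symmetric])
      also have "\<dots> = - exp (-e)" unfolding pde by simp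
      finally have p: "exp e * Vxx x e = - exp (-e) - exp (-e) * Vee x e + exp (-e) * Ve x e" by simp
      show "F1 x e + F2 x e = g (V x e) * (exp e * (Vx x e)\<^sup>2 + exp (-e) * (Ve x e)\<^sup>2) - G (V x e) * exp (-e)"
        unfolding F1_def F2_def p by (simp add: algebra_simps power2_eq_square)
    qed
    also have "\<dots> = ?I (\<lambda>x e. g (V x e) * (exp e * (Vx x e)\<^sup>2 + exp (-e) * (Ve x e)\<^sup>2)) - A"
      unfolding A_def by (rule plane_int_diff) (intro ci)+
    finally show ?thesis by simp
  qed
  \<comment> \<open>divergence theorem for the vertical field; its divergence is \<open>k coth R\<close> where \<open>X = 1\<close>\<close>
  have iii: "?I (\<lambda>x e. g (V x e) * Ve x e * (k * b e) * exp (-e)) = - (k * (C / S)) * A"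
  proof -
    define F where "F = (\<lambda>x e. g (V x e) * Ve x e * (k * b e * exp (-e)) +
        G (V x e) * (k * (exp (s e - R) * X e / S) * exp (-e) - k * b e * exp (-e)))"
    have c: "cont2 F" unfolding F_def by (intro ci) (use S in auto)
    have db: "(b has_real_derivative exp (s e - R) * X e / S) (at e)" for e
      unfolding b_def using S by (auto intro!: derivative_eq_intros s)
    have "?I F = 0"
    proof (rule plane_int_deriv_e[OF a(1) c])
      show "((\<lambda>e. G (V x e) * (k * b e * exp (-e))) has_real_derivative F x e) (at e)" for x e
        unfolding F_def by (rule derivative_eq_intros dGe db refl)+ (simp add: algebra_simps)
    qed (simp add: GV0)
    also have "?I F = ?I (\<lambda>x e. g (V x e) * Ve x e * (k * b e) * exp (-e) + (k * (C / S)) * (G (V x e) * exp (-e)))"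
    proof (rule plane_int_cong)
      fix x e
      show "F x e = g (V x e) * Ve x e * (k * b e) * exp (-e) + (k * (C / S)) * (G (V x e) * exp (-e))"
      proof (cases "c \<le> V x e")
        case True
        then have X1: "X e = 1" by (rule X(3))
        have "exp (s e - R) * X e / S - b e = C / S" unfolding b_def X1 using S by (simp add: field_simps)
        then have "exp (s e - R) * X e / S = C / S + b e" by simp
        then show ?thesis unfolding F_def by (simp add: algebra_simps)
      next
        case False
        then have "G (V x e) = 0" by (intro Gc) simp
        then show ?thesis unfolding F_def by (simp add: algebra_simps)
      qed
    qed
    also have "\<dots> = ?I (\<lambda>x e. g (V x e) * Ve x e * (k * b e) * exp (-e)) + ?I (\<lambda>x e. (k * (C / S)) * (G (V x e) * exp (-e)))"
      by (rule plane_int_add) (intro ci)+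
    also have "?I (\<lambda>x e. (k * (C / S)) * (G (V x e) * exp (-e))) = (k * (C / S)) * A"
      unfolding A_def by (rule plane_int_cmult)
    finally show ?thesis by simp
  qed
  \<comment> \<open>substituting \<open>s\<close> turns this into the integral for the disc\<close>
  have iv: "integral {-a..a} (\<lambda>e. N e * X e) = pi"
  proof -
    obtain T where T: "\<And>t. (T has_real_derivative aw t) (at t)" using antiderivative_real[OF aw_cont] by blast
    have "integral {0..2*R} aw = T (2*R) - T 0"
      using R by (intro integral_unique FTC_real T) simp
    then have 1: "T (2*R) - T 0 = pi * (C - 1) / S"
      using integral_disc_width[OF R] by (simp add: aw_def C_def S_def)
    have "((\<lambda>e. aw (s e) * X e) has_integral T (s a) - T (s (-a))) {-a..a}"
      using a(1) by (intro FTC_real DERIV_chain2[OF T s]) simp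
    then have "((\<lambda>e. k * (aw (s e) * X e)) has_integral k * (pi * (C - 1) / S)) {-a..a}"
      unfolding s_a 1 by (rule has_integral_mult_right)
    moreover have "k * (pi * (C - 1) / S) = pi * (k * ((C - 1) / S))" by simp
    ultimately have "((\<lambda>e. k * (aw (s e) * X e)) has_integral pi) {-a..a}"
      by (simp only: k2 mult_1_right)
    then show ?thesis unfolding N_def mult.assoc by (rule integral_unique)
  qed
  have int1: "f integrable_on {-a..a}" if "continuous_on UNIV f" for f :: "real \<Rightarrow> real"
    by (rule integrable_continuous_real) (rule continuous_on_subset[OF that], auto)
  have v: "integral {-a..a} (\<lambda>e. N e * X' e) \<ge> pi - k * (lam - lam')"
  proof -
    have "integral {-a..a} (\<lambda>e. N e * X e - k * (X e - X' e)) \<le> integral {-a..a} (\<lambda>e. N e * X' e)"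
    proof (rule integral_le)
      show "N e * X e - k * (X e - X' e) \<le> N e * X' e" for e
      proof -
        have "N e * (X e - X' e) \<le> k * (X e - X' e)" using Nk X'(3)[of e] by (intro mult_right_mono) auto
        then show ?thesis by (simp add: algebra_simps)
      qed
    qed (intro int1 continuous_intros N_cont X(1) X'(1))+
    moreover have "integral {-a..a} (\<lambda>e. N e * X e - k * (X e - X' e)) = pi - k * (lam - lam')"
    proof -
      have "integral {-a..a} (\<lambda>e. N e * X e - k * (X e - X' e)) =
          integral {-a..a} (\<lambda>e. N e * X e) - integral {-a..a} (\<lambda>e. k * (X e - X' e))"
        by (rule integral_diff) (intro int1 continuous_intros N_cont X(1) X'(1))+
      also have "integral {-a..a} (\<lambda>e. k * (X e - X' e)) = k * integral {-a..a} (\<lambda>e. X e - X' e)"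
        by (rule integral_mult_right)
      also have "integral {-a..a} (\<lambda>e. X e - X' e) = lam - lam'"
        unfolding lam by (rule integral_diff) (intro int1 X(1) X'(1))+
      finally show ?thesis unfolding iv .
    qed
    ultimately show ?thesis by simp
  qed
  \<comment> \<open>every line that meets \<open>{d \<le> V}\<close> crosses each level between \<open>c\<close> and \<open>d\<close> at least twice\<close>
  have ii: "?I (\<lambda>x e. N e * (g (V x e) * \<bar>Vx x e\<bar>)) \<ge> 2 * G d * (pi - k * (lam - lam'))"
  proof -
    have c: "cont2 (\<lambda>x e. N e * (g (V x e) * \<bar>Vx x e\<bar>))" by (intro ci)
    have slice: "integral {-a..a} (\<lambda>x. g (V x e) * \<bar>Vx x e\<bar>) \<ge> 2 * G d * X' e" for e
    proof -
      have cx: "continuous_on UNIV (\<lambda>x. g (V x e) * \<bar>Vx x e\<bar>)"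
      proof -
        have "cont2 (\<lambda>x e. g (V x e) * \<bar>Vx x e\<bar>)" by (intro ci)
        from cont2_slice1[OF this] show ?thesis .
      qed
      have int: "(\<lambda>x. g (V x e) * \<bar>Vx x e\<bar>) integrable_on {u..v}" for u v
        by (rule integrable_continuous_real) (rule continuous_on_subset[OF cx], auto)
      show ?thesis
      proof (cases "X' e > 0")
        case False
        then have "X' e = 0" using X'(2)[of e] by simp
        then show ?thesis using g(2) by (simp add: integral_nonneg[OF int])
      next
        case True
        then obtain x0 where x0: "d \<le> V x0 e" using X'(4) by blast
        have x0a: "-a \<le> x0" "x0 \<le> a" using a(2)[of x0 e] x0 cd by auto
        have f: "((\<lambda>x. g (V x e) * Vx x e) has_integral G (V v e) - G (V u e)) {u..v}" if "u \<le> v" for u v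
          by (rule FTC_real[OF dGx that])
        have "G d \<le> integral {-a..x0} (\<lambda>x. g (V x e) * \<bar>Vx x e\<bar>)"
        proof -
          have "G (V x0 e) - G (V (-a) e) \<le> integral {-a..x0} (\<lambda>x. g (V x e) * \<bar>Vx x e\<bar>)"
            by (rule has_integral_le[OF f[OF x0a(1)] integrable_integral[OF int]])
               (auto intro!: mult_left_mono g(2))
          moreover have "G (V x0 e) = G d" by (rule Gd[OF x0])
          moreover have "G (V (-a) e) = 0" using GV0 a(1) by simp
          ultimately show ?thesis by simp
        qed
        moreover have "G d \<le> integral {x0..a} (\<lambda>x. g (V x e) * \<bar>Vx x e\<bar>)"
        proof -
          have "- (G (V a e) - G (V x0 e)) \<le> integral {x0..a} (\<lambda>x. g (V x e) * \<bar>Vx x e\<bar>)"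
          proof (rule has_integral_le[OF has_integral_neg[OF f[OF x0a(2)]] integrable_integral[OF int]])
            fix x
            have "g (V x e) * (- Vx x e) \<le> g (V x e) * \<bar>Vx x e\<bar>" by (rule mult_left_mono) (use g(2) in auto)
            then show "- (g (V x e) * Vx x e) \<le> g (V x e) * \<bar>Vx x e\<bar>" by simp
          qed
          moreover have "G (V x0 e) = G d" by (rule Gd[OF x0])
          moreover have "G (V a e) = 0" using GV0 a(1) by simp
          ultimately show ?thesis by simp
        qed
        moreover have "integral {-a..x0} (\<lambda>x. g (V x e) * \<bar>Vx x e\<bar>) + integral {x0..a} (\<lambda>x. g (V x e) * \<bar>Vx x e\<bar>)
            = integral {-a..a} (\<lambda>x. g (V x e) * \<bar>Vx x e\<bar>)"
          by (rule Henstock_Kurzweil_Integration.integral_combine[OF x0a int])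
        moreover have "2 * G d * X' e \<le> 2 * G d"
          using G0[of d] order_trans[OF X'(3) X(2)] by (simp add: mult_left_le)
        ultimately show ?thesis by simp
      qed
    qed
    have cin: "continuous_on {-a..a} (\<lambda>e. integral {-a..a} (\<lambda>x. N e * (g (V x e) * \<bar>Vx x e\<bar>)))"
    proof -
      have "continuous_on UNIV (\<lambda>p. (\<lambda>q. N (snd q) * (g (V (fst q) (snd q)) * \<bar>Vx (fst q) (snd q)\<bar>)) (snd p, fst p))"
        by (rule continuous_on_compose2[OF c]) (auto intro!: continuous_intros)
      then have "continuous_on ({-a..a} \<times> cbox (-a) a) (\<lambda>(e, x). N e * (g (V x e) * \<bar>Vx x e\<bar>))"
        using continuous_on_subset by (fastforce simp: case_prod_unfold)
      from integral_continuous_on_param[OF this] show ?thesis by simp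
    qed
    have "2 * G d * (pi - k * (lam - lam')) \<le> 2 * G d * integral {-a..a} (\<lambda>e. N e * X' e)"
      using v G0[of d] by (simp add: mult_left_mono)
    also have "\<dots> = integral {-a..a} (\<lambda>e. 2 * G d * (N e * X' e))"
      by (rule integral_mult_right[symmetric])
    also have "\<dots> \<le> integral {-a..a} (\<lambda>e. integral {-a..a} (\<lambda>x. N e * (g (V x e) * \<bar>Vx x e\<bar>)))"
    proof (rule integral_le)
      show "(\<lambda>e. 2 * G d * (N e * X' e)) integrable_on {-a..a}"
        by (intro int1 continuous_intros N_cont X'(1))
      show "(\<lambda>e. integral {-a..a} (\<lambda>x. N e * (g (V x e) * \<bar>Vx x e\<bar>))) integrable_on {-a..a}"
        by (rule integrable_continuous_real[OF cin])
      fix e assume e: "e \<in> {-a..a}"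
      have "2 * G d * (N e * X' e) = N e * (2 * G d * X' e)" by simp
      also have "\<dots> \<le> N e * integral {-a..a} (\<lambda>x. g (V x e) * \<bar>Vx x e\<bar>)"
        using slice N0[of e] e by (intro mult_left_mono) auto
      finally show "2 * G d * (N e * X' e) \<le> integral {-a..a} (\<lambda>x. N e * (g (V x e) * \<bar>Vx x e\<bar>))"
        by simp
    qed
    also have "\<dots> = ?I (\<lambda>x e. N e * (g (V x e) * \<bar>Vx x e\<bar>))"
      by (rule plane_int_iter_ex[OF c, symmetric])
    finally show ?thesis .
  qed
  \<comment> \<open>Cauchy-Schwarz for \<open>(N, -k b)\<close>, followed by \<open>2 a - a\<^sup>2 \<le> 1\<close>\<close>
  have "?I (\<lambda>x e. 2 * (N e * (g (V x e) * \<bar>Vx x e\<bar>)) - 2 * (g (V x e) * Ve x e * (k * b e) * exp (-e))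
        - k\<^sup>2 * (g (V x e) * (exp e * (Vx x e)\<^sup>2 + exp (-e) * (Ve x e)\<^sup>2)))
      \<le> ?I (\<lambda>x e. g (V x e) * exp (-e))"
  proof (rule plane_int_mono)
    fix x e :: real assume "\<bar>x\<bar> \<le> a" and e: "\<bar>e\<bar> \<le> a"
    define p q where "p = exp e * \<bar>Vx x e\<bar>" and "q = Ve x e"
    define w where "w = sqrt (p\<^sup>2 + q\<^sup>2)"
    have w2: "w\<^sup>2 = p\<^sup>2 + q\<^sup>2" unfolding w_def by simp
    have w0: "w \<ge> 0" unfolding w_def by simp
    have "(N e * p + (- (k * b e)) * q)\<^sup>2 \<le> ((N e)\<^sup>2 + (k * b e)\<^sup>2) * (p\<^sup>2 + q\<^sup>2)"
    proof -
      have "((N e)\<^sup>2 + (k * b e)\<^sup>2) * (p\<^sup>2 + q\<^sup>2) - (N e * p + (- (k * b e)) * q)\<^sup>2 = (N e * q + k * b e * p)\<^sup>2"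
        by (simp add: power2_eq_square algebra_simps)
      then show ?thesis by (smt (verit) zero_le_power2)
    qed
    also have "\<dots> = (k * w)\<^sup>2" unfolding Nb[OF e] w2 by (simp add: power_mult_distrib w2)
    finally have "N e * p - k * b e * q \<le> k * w"
      using abs_le_square_iff[of "N e * p + (- (k * b e)) * q" "k * w"] k w0 by simp
    moreover have "2 * (k * w) - (k * w)\<^sup>2 \<le> 1"
      using zero_le_power2[of "1 - k * w"] by (simp add: power2_eq_square algebra_simps)
    ultimately have "2 * (N e * p - k * b e * q) - k\<^sup>2 * (p\<^sup>2 + q\<^sup>2) \<le> 1"
      by (simp add: power_mult_distrib w2[symmetric])
    then have "g (V x e) * exp (-e) * (2 * (N e * p - k * b e * q) - k\<^sup>2 * (p\<^sup>2 + q\<^sup>2)) \<le> g (V x e) * exp (-e) * 1"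
      using g(2) by (intro mult_left_mono) auto
    moreover have "exp (-e) * p = \<bar>Vx x e\<bar>" unfolding p_def by (simp add: exp_add[symmetric] mult.assoc[symmetric])
    moreover have "exp (-e) * p\<^sup>2 = exp e * (Vx x e)\<^sup>2" unfolding p_def
      by (simp add: power_mult_distrib power2_eq_square exp_add[symmetric] mult.assoc[symmetric])
    moreover have "g (V x e) * exp (-e) * (2 * (N e * p - k * b e * q) - k\<^sup>2 * (p\<^sup>2 + q\<^sup>2))
       = 2 * (N e * (g (V x e) * (exp (-e) * p))) - 2 * (g (V x e) * q * (k * b e) * exp (-e))
        - k\<^sup>2 * (g (V x e) * (exp (-e) * p\<^sup>2 + exp (-e) * q\<^sup>2))"
      by (simp add: algebra_simps)
    ultimately show "2 * (N e * (g (V x e) * \<bar>Vx x e\<bar>)) - 2 * (g (V x e) * Ve x e * (k * b e) * exp (-e))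
        - k\<^sup>2 * (g (V x e) * (exp e * (Vx x e)\<^sup>2 + exp (-e) * (Ve x e)\<^sup>2)) \<le> g (V x e) * exp (-e)"
      by (simp add: q_def)
  qed (intro ci)+
  also have "?I (\<lambda>x e. 2 * (N e * (g (V x e) * \<bar>Vx x e\<bar>)) - 2 * (g (V x e) * Ve x e * (k * b e) * exp (-e))
        - k\<^sup>2 * (g (V x e) * (exp e * (Vx x e)\<^sup>2 + exp (-e) * (Ve x e)\<^sup>2)))
     = 2 * ?I (\<lambda>x e. N e * (g (V x e) * \<bar>Vx x e\<bar>)) - 2 * ?I (\<lambda>x e. g (V x e) * Ve x e * (k * b e) * exp (-e))
       - k\<^sup>2 * ?I (\<lambda>x e. g (V x e) * (exp e * (Vx x e)\<^sup>2 + exp (-e) * (Ve x e)\<^sup>2))"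
    unfolding plane_int_cmult[symmetric]
    by (subst plane_int_diff, (intro ci)+, subst plane_int_diff, (intro ci)+) (rule refl)
  finally have fin: "2 * ?I (\<lambda>x e. N e * (g (V x e) * \<bar>Vx x e\<bar>)) + 2 * (k * (C / S)) * A - k\<^sup>2 * A
      \<le> ?I (\<lambda>x e. g (V x e) * exp (-e))"
    unfolding i iii by simp
  moreover have "2 * (k * (C / S)) * A - k\<^sup>2 * A = A"
  proof -
    have "2 * (k * (C / S)) * A - k\<^sup>2 * A = (2 * k * (C / S) - k\<^sup>2) * A" by (simp add: algebra_simps)
    then show ?thesis unfolding k1 by simp
  qed
  ultimately have "4 * G d * (pi - k * (lam - lam')) + A \<le> ?I (\<lambda>x e. g (V x e) * exp (-e))"
    using ii by linarith
  then show ?thesis unfolding A_def[symmetric] k_def C_def S_def R_def by (simp add: algebra_simps)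
qed

end

lemma sum_hats:
  fixes y :: real
  assumes "0 \<le> y" "y \<le> real n"
  shows "(\<Sum>j\<le>n. max 0 (1 - \<bar>y - real j\<bar>)) = 1"
  using assms
proof (induction n)
  case (Suc n)
  show ?case
  proof (cases "y \<le> real n")
    case True
    then show ?thesis using Suc by simp
  next
    case False
    have "(\<Sum>j\<le>n. max 0 (1 - \<bar>y - real j\<bar>)) = (\<Sum>j\<le>n. if j = n then 1 - (y - real n) else 0)"
    proof (rule sum.cong)
      fix j assume "j \<in> {..n}"
      then have "j = n \<or> real j + 1 \<le> real n" by auto
      then show "max 0 (1 - \<bar>y - real j\<bar>) = (if j = n then 1 - (y - real n) else 0)"
        using False Suc.prems by auto
    qed simp
    also have "\<dots> = 1 - (y - real n)" by simp
    finally show ?thesis using False Suc.prems by simp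
  qed
qed simp

lemma sum_shift3:
  fixes L :: "nat \<Rightarrow> real"
  shows "(\<Sum>j\<le>n. L j - L (j + 3)) = L 0 + L 1 + L 2 - L (n + 1) - L (n + 2) - L (n + 3)"
  by (induction n) (simp_all add: eval_nat_numeral)

context torsion_plane begin

lemma projection_closed: "closed {e. \<exists>x. s \<le> V x e}"
proof -
  obtain a where a: "\<And>x e. s \<le> V x e \<Longrightarrow> \<bar>x\<bar> < a \<and> \<bar>e\<bar> < a" using proper by blast
  define K where "K = {p. s \<le> V (fst p) (snd p)}"
  have "closed K" unfolding K_def using cont_V(1) by (intro closed_Collect_le continuous_on_const)
  moreover have "K \<subseteq> cbox (-a,-a) (a,a)" unfolding K_def using a by (force simp: abs_less_iff)
  ultimately have "compact K" by (meson bounded_cbox bounded_subset compact_eq_bounded_closed)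
  then have "compact (snd ` K)" by (intro compact_continuous_image continuous_intros)
  moreover have "snd ` K = {e. \<exists>x. s \<le> V x e}" unfolding K_def by (auto simp: image_iff)
  ultimately show ?thesis using compact_imp_closed by metis
qed

lemma projection_open: "open {e. \<exists>x. s < V x e}"
proof -
  have "open {e. s < V x e}" for x
  proof (rule open_Collect_less)
    show "continuous_on UNIV (V x)"
      using V_e by (meson DERIV_isCont continuous_at_imp_continuous_on)
  qed simp
  moreover have "{e. \<exists>x. s < V x e} = (\<Union>x. {e. s < V x e})" by auto
  ultimately show ?thesis by auto
qed

lemma projection_cutoff:
  assumes "s' < s"
  obtains X :: "real \<Rightarrow> real" where "continuous_on UNIV X" "\<And>e. 0 \<le> X e \<and> X e \<le> 1"
    "\<And>x e. s \<le> V x e \<Longrightarrow> X e = 1" "\<And>e. X e > 0 \<Longrightarrow> \<exists>x. s' < V x e"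
proof -
  have cl: "closed (- {e. \<exists>x. s' < V x e})" using projection_open by auto
  have dis: "{e. \<exists>x. s \<le> V x e} \<inter> - {e. \<exists>x. s' < V x e} = {}"
  proof -
    have "s' < V x e" if "s \<le> V x e" for x e using assms that by linarith
    then show ?thesis by auto
  qed
  obtain X :: "real \<Rightarrow> real" where X: "continuous_on UNIV X" "\<And>e. X e \<in> closed_segment 1 0"
    "\<And>e. e \<in> {e. \<exists>x. s \<le> V x e} \<Longrightarrow> X e = 1" "\<And>e. e \<in> - {e. \<exists>x. s' < V x e} \<Longrightarrow> X e = 0"
    using Urysohn[OF projection_closed cl dis, of "1::real" "0::real"] by blast
  show ?thesis
  proof (rule that[OF X(1)])
    show "0 \<le> X e \<and> X e \<le> 1" for e using X(2)[of e] by (simp add: closed_segment_eq_real_ivl)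
    show "s \<le> V x e \<Longrightarrow> X e = 1" for x e using X(3) by blast
    show "X e > 0 \<Longrightarrow> \<exists>x. s' < V x e" for e using X(4)[of e] by force
  qed
qed

text \<open>
  The weight \<open>g\<close> is cut by hat functions of half-width \<open>D\<close> into pieces to which \<open>slab_inequality\<close> applies.
  With \<open>L i\<close> the length of the projection near the level \<open>c + (i - 1) D\<close>, the \<open>j\<close>-th piece
  costs an error of order \<open>D (L j - L (j + 3))\<close>. Since these differences telescope, the total error is
  \<open>O(D)\<close>. The point \<open>(x1, e1)\<close> above all levels in use keeps the lengths away from zero,
  and thereby \<open>k = coth (R/2)\<close> bounded.
\<close>

lemma superlevel_inequality:
  assumes g: "continuous_on UNIV g" "\<And>t. g t \<ge> 0" and supp: "\<And>t. t \<le> c \<or> d \<le> t \<Longrightarrow> g t = 0"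
    and cd: "c < d" and top: "d < V x1 e1"
    and G: "\<And>t. (G has_real_derivative g t) (at t)" and Gc: "G c = 0"
    and a: "a > 0" "\<And>x e. c - 1 \<le> V x e \<Longrightarrow> \<bar>x\<bar> < a \<and> \<bar>e\<bar> < a"
  shows "plane_int a (\<lambda>x e. g (V x e) * exp (-e)) \<ge> plane_int a (\<lambda>x e. G (V x e) * exp (-e)) + 4 * pi * G d"
proof -
  let ?I = "plane_int a"
  define LHS RHS where "LHS = ?I (\<lambda>x e. g (V x e) * exp (-e))" and "RHS = ?I (\<lambda>x e. G (V x e) * exp (-e)) + 4 * pi * G d"
  have "compact (g ` {c..d})" by (rule compact_continuous_image[OF continuous_on_subset[OF g(1)]]) auto
  then have "bounded (g ` {c..d})" by (rule compact_imp_bounded)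
  then obtain M0 where M0: "\<And>t. t \<in> {c..d} \<Longrightarrow> norm (g t) \<le> M0" unfolding bounded_iff by blast
  define M where "M = max M0 0"
  have M: "0 \<le> M" "g t \<le> M" for t
    using M0[of t] supp[of t] by (auto simp: M_def max_def not_le split: if_splits) (smt (verit) atLeastAtMost_iff)+
  have contV: "continuous_on UNIV (\<lambda>e. V x1 e)"
    using V_e by (meson DERIV_isCont continuous_at_imp_continuous_on)
  have "open {e. d < V x1 e}" by (rule open_Collect_less) (use contV in auto)
  then obtain r where r: "r > 0" "cball e1 r \<subseteq> {e. d < V x1 e}"
    using top open_contains_cball by blast
  have rV: "d < V x1 e" if "e \<in> {e1-r..e1+r}" for e
    using r(2) that by (auto simp: subset_iff dist_real_def abs_le_iff)
  define K where "K = 2 / sinh r + 1"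
  have K: "K > 0" unfolding K_def using r(1) by (intro add_pos_pos) auto
  have coth_le: "(cosh x + 1) / sinh x \<le> K" if "r \<le> x" for x
  proof -
    have sx: "sinh x \<ge> sinh r" "sinh r > 0" using that r(1) by auto
    have "(cosh x + 1) / sinh x = (exp (-x) + 1) / sinh x + 1"
      using sx cosh_minus_sinh[of x] by (simp add: field_simps)
    also have "\<dots> \<le> 2 / sinh r + 1"
      using sx that r(1) by (intro add_right_mono frac_le) auto
    finally show ?thesis unfolding K_def .
  qed
  have int1: "f integrable_on {u..v}" if "continuous_on UNIV f" for f :: "real \<Rightarrow> real" and u v
    by (rule integrable_continuous_real) (rule continuous_on_subset[OF that], auto)
  have step: "RHS - 48 * M * K * a * (d - c) / real n \<le> LHS" if n: "real n > d - c" for n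
  proof -
    define D where "D = (d - c) / real n"
    have n0: "real n > 0" using n cd by linarith
    have D: "0 < D" "D < 1" "real n * D = d - c" unfolding D_def using n n0 cd by (auto simp: field_simps)
    \<comment> \<open>the \<open>i\<close>-th cutoff lies between the projections of two levels at distance \<open>D\<close>\<close>
    define P where "P = (\<lambda>(i::nat) (X::real \<Rightarrow> real). continuous_on UNIV X \<and> (\<forall>e. 0 \<le> X e \<and> X e \<le> 1) \<and>
       (\<forall>x e. c + (real i - 1) * D \<le> V x e \<longrightarrow> X e = 1) \<and>
       (\<forall>e. (0::real) < X e \<longrightarrow> (\<exists>x. c + (real i - 2) * D < V x e)))"
    have "\<forall>i. \<exists>X. P i X"
    proof
      fix i :: nat
      have "c + (real i - 2) * D < c + (real i - 1) * D" using D(1) by (simp add: algebra_simps)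
      from projection_cutoff[OF this] show "\<exists>X. P i X" unfolding P_def by metis
    qed
    then obtain X where XX: "\<And>i. P i (X i)" by metis
    have Xc: "continuous_on UNIV (X i)" for i using XX[of i] unfolding P_def by (rule conjunct1)
    have X01: "0 \<le> X i e" "X i e \<le> 1" for i e using XX[of i] unfolding P_def by blast+
    have X1: "X i e = 1" if "c + (real i - 1) * D \<le> V x e" for i x e
      using XX[of i] that unfolding P_def by blast
    have X0: "\<exists>x. c + (real i - 2) * D < V x e" if "X i e > 0" for i e
      using XX[of i] that unfolding P_def by blast
    define L where "L = (\<lambda>i. integral {-a..a} (X i))"
    have L_le: "L i \<le> 2 * a" and L_ge: "0 \<le> L i" for i
    proof -
      have "L i \<le> integral {-a..a} (\<lambda>_. 1)" unfolding L_def
        by (rule integral_le) (use X01 in \<open>auto intro!: int1 Xc\<close>)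
      then show "L i \<le> 2 * a" using a(1) by simp
      show "0 \<le> L i" unfolding L_def by (rule integral_nonneg) (use X01 in \<open>auto intro!: int1 Xc\<close>)
    qed
    have L_big: "2 * r \<le> L i" if "i \<le> n" for i
    proof -
      have "c + (real i - 1) * D \<le> d"
      proof -
        have "(real i - 1) * D \<le> real n * D" using that D(1) by (intro mult_right_mono) auto
        then show ?thesis using D(3) by simp
      qed
      then have one: "X i e = 1" if "e \<in> {e1-r..e1+r}" for e
        using rV[OF that] X1[of i x1 e] by simp
      have sub: "{e1-r..e1+r} \<subseteq> {-a..a}"
      proof
        fix e assume "e \<in> {e1-r..e1+r}"
        then show "e \<in> {-a..a}" using rV[of e] a(2)[of x1 e] cd by (auto simp: abs_less_iff)
      qed
      have "2 * r = integral {e1-r..e1+r} (\<lambda>_. 1::real)" using r(1) by simp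
      also have "\<dots> = integral {e1-r..e1+r} (X i)" by (rule integral_cong) (simp add: one)
      also have "\<dots> \<le> L i" unfolding L_def
        by (rule integral_subset_le[OF sub]) (use X01 in \<open>auto intro!: int1 Xc\<close>)
      finally show ?thesis .
    qed
    define h where "h = (\<lambda>j t. g t * max 0 (1 - \<bar>(t - c) / D - real j\<bar>))"
    have h_cont: "continuous_on UNIV (h j)" for j
      unfolding h_def using D(1) by (intro continuous_intros g(1)) auto
    have h0: "0 \<le> h j t" for j t unfolding h_def using g(2) by simp
    have h_le: "h j t \<le> M" for j t
    proof -
      have "g t * max 0 (1 - \<bar>(t - c) / D - real j\<bar>) \<le> g t * 1" using g(2) by (intro mult_left_mono) auto
      then show ?thesis unfolding h_def using M(2)[of t] by simp
    qed
    have h_supp: "h j t = 0" if "t \<le> c + (real j - 1) * D \<or> c + (real j + 1) * D \<le> t" for j t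
    proof -
      have "(t - c) / D \<le> real j - 1 \<or> real j + 1 \<le> (t - c) / D"
        using that D(1) by (auto simp: field_simps)
      then show ?thesis unfolding h_def by auto
    qed
    have h_sum: "(\<Sum>j\<le>n. h j t) = g t" for t
    proof (cases "c \<le> t \<and> t \<le> d")
      case True
      then have "0 \<le> (t - c) / D" "(t - c) / D \<le> real n"
        using D by (auto simp: divide_le_eq mult.commute)
      from sum_hats[OF this] show ?thesis unfolding h_def sum_distrib_left[symmetric] by simp
    next
      case False
      then have "g t = 0" using supp by auto
      then show ?thesis unfolding h_def by simp
    qed
    obtain H0 where H0: "\<And>j t. (H0 j has_real_derivative h j t) (at t)"
    proof -
      have "\<forall>j. \<exists>F. \<forall>t. (F has_real_derivative h j t) (at t)"
        using antiderivative_real[OF h_cont] by metis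
      then show ?thesis using that by metis
    qed
    define H where "H = (\<lambda>j t. H0 j t - H0 j (c - 2))"
    have H: "(H j has_real_derivative h j t) (at t)" for j t
      unfolding H_def using H0 by (auto intro!: derivative_eq_intros)
    have const: "F u = F v" if F: "\<And>t. (F has_real_derivative f t) (at t)" and z: "\<And>t. \<lbrakk>u \<le> t; t \<le> v\<rbrakk> \<Longrightarrow> f t = 0" and uv: "u \<le> v"
      for F f and u v :: real
    proof -
      have i1: "(f has_integral F v - F u) {u..v}" by (rule FTC_real[OF F uv])
      have i2: "(f has_integral 0) {u..v}" by (rule has_integral_is_0) (use z in auto)
      show ?thesis using has_integral_unique[OF i1 i2] by simp
    qed
    have Hc: "H j t = 0" if t: "t \<le> c + (real j - 1) * D" for j t
    proof -
      have "c - 2 \<le> c + (real j - 1) * D"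
      proof -
        have "- D \<le> (real j - 1) * D" using D(1) by (simp add: algebra_simps)
        then show ?thesis using D by linarith
      qed
      then have z: "h j s = 0" if "s \<le> max t (c - 2)" for s
        using t that by (intro h_supp) auto
      have "H j (min t (c - 2)) = H j t" by (rule const[OF H]) (use z in auto)
      moreover have "H j (min t (c - 2)) = H j (c - 2)" by (rule const[OF H]) (use z in auto)
      ultimately show ?thesis by (simp add: H_def)
    qed
    have Hd: "H j t = H j (c + (real j + 1) * D)" if "c + (real j + 1) * D \<le> t" for j t
    proof -
      have "H j (c + (real j + 1) * D) = H j t"
      proof (rule const[OF H])
        fix s assume "c + (real j + 1) * D \<le> s"
        then show "h j s = 0" by (intro h_supp disjI2)
      qed (rule that)
      then show ?thesis by simp
    qed
    have H_sum: "(\<Sum>j\<le>n. H j t) = G t" for t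
    proof -
      define Q where "Q = (\<lambda>t. (\<Sum>j\<le>n. H j t) - G t)"
      have dQ: "(Q has_real_derivative 0) (at t)" for t
      proof -
        have "(Q has_real_derivative (\<Sum>j\<le>n. h j t) - g t) (at t)"
          unfolding Q_def by (intro DERIV_diff DERIV_sum H G)
        then show ?thesis unfolding h_sum by simp
      qed
      have "G (c - 2) = G c" by (rule const[OF G]) (auto intro: supp)
      then have "Q (c - 2) = 0" unfolding Q_def using Gc by (simp add: H_def)
      moreover have "Q t = Q (c - 2)"
        by (rule DERIV_isconst_all) (use dQ in blast)
      ultimately show ?thesis by (simp add: Q_def)
    qed
    define Hi where "Hi = (\<lambda>j. H j (c + (real j + 1) * D))"
    have Hi_range: "0 \<le> Hi j \<and> Hi j \<le> 2 * M * D" for j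
    proof -
      let ?u = "c + (real j - 1) * D" and ?v = "c + (real j + 1) * D"
      have uv: "?u \<le> ?v" using D(1) by (simp add: algebra_simps)
      have i: "(h j has_integral Hi j) {?u..?v}"
        using FTC_real[OF H uv, of j] Hc[of ?u j] by (simp add: Hi_def)
      have c: "((\<lambda>_. M) has_integral M * (?v - ?u)) {?u..?v}"
        using has_integral_const_real[of M ?u ?v] uv by (simp add: mult.commute)
      have "Hi j \<le> M * (?v - ?u)" by (rule has_integral_le[OF i c]) (rule h_le)
      also have "M * (?v - ?u) = 2 * M * D" by (simp add: algebra_simps)
      finally show ?thesis using has_integral_nonneg[OF i h0] by simp
    qed
    have Hi_sum: "(\<Sum>j\<le>n. Hi j) = G d"
    proof -
      have "G d = G (d + D)" by (rule const[OF G]) (use D in \<open>auto intro: supp\<close>)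
      also have "\<dots> = (\<Sum>j\<le>n. H j (d + D))" by (rule H_sum[symmetric])
      also have "\<dots> = (\<Sum>j\<le>n. Hi j)"
      proof (rule sum.cong)
        fix j assume "j \<in> {..n}"
        then have "real j * D \<le> real n * D" using D(1) by (intro mult_right_mono) auto
        then have "c + (real j + 1) * D \<le> d + D" using D(3) by (simp add: algebra_simps)
        then show "H j (d + D) = Hi j" unfolding Hi_def by (rule Hd)
      qed simp
      finally show ?thesis by simp
    qed
    have slab: "?I (\<lambda>x e. H j (V x e) * exp (-e)) + Hi j * (4 * pi) - 8 * M * D * K * (L j - L (j + 3))
        \<le> ?I (\<lambda>x e. h j (V x e) * exp (-e))" if j: "j \<le> n" for j
    proof -
      have mono: "X (j + 3) e \<le> X j e" for e
      proof (cases "X (j + 3) e > 0")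
        case True
        then obtain x where "c + (real (j + 3) - 2) * D < V x e" using X0 by blast
        moreover have "c + (real j - 1) * D \<le> c + (real (j + 3) - 2) * D"
          using D(1) by (simp add: algebra_simps)
        ultimately have "X j e = 1" by (intro X1[of j x]) linarith
        then show ?thesis using X01 by simp
      qed (use X01[of j e] in linarith)
      have "Hi j * (4 * pi - 4 * ((cosh (L j / 2) + 1) / sinh (L j / 2)) * (L j - L (j + 3)))
         + ?I (\<lambda>x e. H j (V x e) * exp (-e)) \<le> ?I (\<lambda>x e. h j (V x e) * exp (-e))"
        unfolding Hi_def
      proof (subst add.commute, rule slab_inequality[where X = "X j" and X' = "X (j + 3)" and c = "c + (real j - 1) * D"])
        show "H j t = 0" if "t \<le> c + (real j - 1) * D" for t using Hc that by blast
        show "H j t = H j (c + (real j + 1) * D)" if "c + (real j + 1) * D \<le> t" for t using Hd that by blast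
        show "c + (real j - 1) * D \<le> c + (real j + 1) * D" using D(1) by (simp add: algebra_simps)
        show "\<bar>x\<bar> < a \<and> \<bar>e\<bar> < a" if "c + (real j - 1) * D \<le> V x e" for x e
        proof (rule a(2))
          have "- D \<le> (real j - 1) * D" using D(1) by (simp add: algebra_simps)
          then show "c - 1 \<le> V x e" using that D by linarith
        qed
        show "\<exists>x. c + (real j + 1) * D \<le> V x e" if pos: "X (j + 3) e > 0" for e
        proof -
          obtain x where "c + (real (j + 3) - 2) * D < V x e" using X0[OF pos] by blast
          moreover have "real (j + 3) - 2 = real j + 1" by simp
          ultimately show ?thesis by (metis less_imp_le)
        qed
        show "0 < L j" using L_big[OF j] r(1) by linarith
      qed (use h_cont h0 H a(1) Xc X01 X1 mono in \<open>auto simp: L_def\<close>)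
      moreover have "Hi j * (4 * ((cosh (L j / 2) + 1) / sinh (L j / 2)) * (L j - L (j + 3)))
          \<le> (2 * M * D) * (4 * K * (L j - L (j + 3)))"
      proof -
        have "L (j + 3) \<le> L j" unfolding L_def
          by (rule integral_le[OF int1[OF Xc] int1[OF Xc]]) (rule mono)
        then have lam: "0 \<le> L j - L (j + 3)" by simp
        have sj: "0 < sinh (L j / 2)" using L_big[OF j] r(1) by simp
        show ?thesis
        proof (intro mult_mono)
          show "(cosh (L j / 2) + 1) / sinh (L j / 2) \<le> K" using L_big[OF j] by (intro coth_le) simp
        qed (use Hi_range lam K M D sj in auto)
      qed
      ultimately show ?thesis by (simp add: algebra_simps)
    qed
    have cV: "continuous_on UNIV (\<lambda>p. q (V (fst p) (snd p)) * exp (- snd p))" if "continuous_on UNIV q" for q :: "real \<Rightarrow> real"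
      by (intro continuous_intros continuous_on_compose2[OF that cont_V(1)]) auto
    have H_cont: "continuous_on UNIV (H j)" for j
      using H by (meson DERIV_isCont continuous_at_imp_continuous_on)
    have "?I (\<lambda>x e. \<Sum>j\<le>n. H j (V x e) * exp (-e)) + G d * (4 * pi) - 8 * M * D * K * (\<Sum>j\<le>n. L j - L (j + 3))
      = (\<Sum>j\<le>n. ?I (\<lambda>x e. H j (V x e) * exp (-e)) + Hi j * (4 * pi) - 8 * M * D * K * (L j - L (j + 3)))"
      unfolding Hi_sum[symmetric]
      by (subst plane_int_sum) (auto simp: sum.distrib sum_subtractf sum_distrib_left[symmetric] sum_distrib_right[symmetric] intro!: cV H_cont)
    also have "\<dots> \<le> (\<Sum>j\<le>n. ?I (\<lambda>x e. h j (V x e) * exp (-e)))"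
      by (rule sum_mono) (use slab in auto)
    also have "\<dots> = ?I (\<lambda>x e. \<Sum>j\<le>n. h j (V x e) * exp (-e))"
      by (subst plane_int_sum) (auto intro!: cV h_cont)
    finally have "RHS - 8 * M * D * K * (\<Sum>j\<le>n. L j - L (j + 3)) \<le> LHS"
      unfolding LHS_def RHS_def sum_distrib_right[symmetric] h_sum H_sum by (simp add: mult.commute)
    moreover have "8 * M * D * K * (\<Sum>j\<le>n. L j - L (j + 3)) \<le> 8 * M * D * K * (6 * a)"
    proof (rule mult_left_mono)
      show "(\<Sum>j\<le>n. L j - L (j + 3)) \<le> 6 * a"
        unfolding sum_shift3 using L_le[of 0] L_le[of 1] L_le[of 2] L_ge[of "n+1"] L_ge[of "n+2"] L_ge[of "n+3"]
        by linarith
    qed (use M D K in simp)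
    moreover have "8 * M * D * K * (6 * a) = 48 * M * K * a * (d - c) / real n" by (simp add: D_def)
    ultimately show ?thesis by linarith
  qed
  have "(\<lambda>n. RHS - 48 * M * K * a * (d - c) / real n) \<longlonglongrightarrow> RHS - 0"
    by (intro tendsto_diff tendsto_const lim_const_over_n)
  moreover have "\<forall>\<^sub>F n in sequentially. RHS - 48 * M * K * a * (d - c) / real n \<le> LHS"
  proof -
    obtain N :: nat where "real N > d - c" using reals_Archimedean2 by blast
    then have "RHS - 48 * M * K * a * (d - c) / real n \<le> LHS" if "n \<ge> N" for n
      using that by (intro step) linarith
    then show ?thesis using eventually_sequentially by blast
  qed
  ultimately have "RHS - 0 \<le> LHS" by (intro tendsto_upperbound) auto
  then show ?thesis unfolding LHS_def RHS_def by simp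
qed

end

section \<open>The disc in half-plane coordinates\<close>

lemma Basis_real2: "(Basis :: (real^2) set) = {axis 1 1, axis 2 1}"
  by (auto simp: Basis_vec_def UNIV_2)

lemma axis_real2_neq: "axis 1 (1::real) \<noteq> (axis 2 1 :: real^2)"
  by (simp add: axis_eq_axis)

text \<open>
  The change of variables below is carried out in \<open>real^2\<close>. This lemma and the next one identify
  Lebesgue measure on \<open>real^2\<close> with that on the complex numbers and on pairs.
\<close>

lemma lborel_real2_complex: "lborel = distr (lborel :: (real^2) measure) borel (\<lambda>p. Complex (p$1) (p$2))"
proof (rule lborel_eqI)
  fix l u :: complex assume le: "\<And>b. b \<in> Basis \<Longrightarrow> l \<bullet> b \<le> u \<bullet> b"
  have le': "Re l \<le> Re u" "Im l \<le> Im u" using le[of 1] le[of \<i>] by (auto simp: Basis_complex_def)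
  have m: "(\<lambda>p::real^2. Complex (p$1) (p$2)) \<in> borel_measurable lborel"
  proof -
    have "continuous_on UNIV (\<lambda>p::real^2. Complex (p$1) (p$2))"
      unfolding Complex_eq by (intro continuous_intros)
    then show ?thesis by (simp add: borel_measurable_continuous_onI)
  qed
  define l' u' :: "real^2" where "l' = (\<chi> i. if i = 1 then Re l else Im l)" and "u' = (\<chi> i. if i = 1 then Re u else Im u)"
  have "(\<lambda>p::real^2. Complex (p$1) (p$2)) -` box l u = box l' u'"
    by (auto simp: box_def Basis_real2 Basis_complex_def inner_axis l'_def u'_def)
  then have "emeasure (distr (lborel :: (real^2) measure) borel (\<lambda>p. Complex (p$1) (p$2))) (box l u) = emeasure lborel (box l' u')"
    using m by (subst emeasure_distr) auto
  also have "\<dots> = (\<Prod>b\<in>Basis. (u' - l') \<bullet> b)"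
    by (rule emeasure_lborel_box) (use le' in \<open>auto simp: Basis_real2 inner_axis l'_def u'_def\<close>)
  also have "(\<Prod>b\<in>Basis. (u' - l') \<bullet> b) = (\<Prod>b\<in>Basis. (u - l) \<bullet> b)"
    by (simp add: Basis_real2 axis_real2_neq Basis_complex_def inner_axis l'_def u'_def)
  finally show "emeasure (distr (lborel :: (real^2) measure) borel (\<lambda>p. Complex (p$1) (p$2))) (box l u) = (\<Prod>b\<in>Basis. (u - l) \<bullet> b)" .
qed simp

lemma lborel_real2_prod: "lborel = distr (lborel :: (real^2) measure) borel (\<lambda>p. (p$1, p$2))"
proof (rule lborel_eqI)
  fix l u :: "real \<times> real" assume le: "\<And>b. b \<in> Basis \<Longrightarrow> l \<bullet> b \<le> u \<bullet> b"
  have le': "fst l \<le> fst u" "snd l \<le> snd u" using le[of "(1,0)"] le[of "(0,1)"] by (auto simp: Basis_prod_def inner_prod_def)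
  have m: "(\<lambda>p::real^2. (p$1, p$2)) \<in> borel_measurable lborel"
  proof -
    have "continuous_on UNIV (\<lambda>p::real^2. (p$1, p$2))" by (intro continuous_intros)
    then show ?thesis by (simp add: borel_measurable_continuous_onI)
  qed
  define l' u' :: "real^2" where "l' = (\<chi> i. if i = 1 then fst l else snd l)" and "u' = (\<chi> i. if i = 1 then fst u else snd u)"
  have "(\<lambda>p::real^2. (p$1, p$2)) -` box l u = box l' u'"
    by (auto simp: box_def Basis_real2 Basis_prod_def inner_prod_def inner_axis l'_def u'_def)
  then have "emeasure (distr (lborel :: (real^2) measure) borel (\<lambda>p. (p$1, p$2))) (box l u) = emeasure lborel (box l' u')"
    using m by (subst emeasure_distr) auto
  also have "\<dots> = (\<Prod>b\<in>Basis. (u' - l') \<bullet> b)"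
    by (rule emeasure_lborel_box) (use le' in \<open>auto simp: Basis_real2 inner_axis l'_def u'_def\<close>)
  also have "(\<Prod>b\<in>Basis. (u' - l') \<bullet> b) = (\<Prod>b\<in>Basis. (u - l) \<bullet> b)"
    by (simp add: Basis_real2 axis_real2_neq Basis_prod_def inner_prod_def inner_axis l'_def u'_def)
  finally show "emeasure (distr (lborel :: (real^2) measure) borel (\<lambda>p. (p$1, p$2))) (box l u) = (\<Prod>b\<in>Basis. (u - l) \<bullet> b)" .
qed simp

definition half_plane_pt :: "real \<Rightarrow> real \<Rightarrow> complex" where "half_plane_pt x e = Complex x (exp e)"

definition disc_coord :: "real \<Rightarrow> real \<Rightarrow> complex" where
  "disc_coord x e = (half_plane_pt x e - \<i>) / (half_plane_pt x e + \<i>)"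

lemma half_plane_pt_plus_i_nonzero: "half_plane_pt x e + \<i> \<noteq> 0"
proof -
  have "Im (half_plane_pt x e + \<i>) > 0" by (simp add: half_plane_pt_def add_pos_pos)
  then show ?thesis by (metis order_less_irrefl zero_complex.simps(2))
qed

lemma norm_half_plane_pt_plus_i: "(norm (half_plane_pt x e + \<i>))\<^sup>2 = x\<^sup>2 + (exp e + 1)\<^sup>2"
  by (simp add: half_plane_pt_def cmod_power2)

text \<open>
  The Cayley transform maps the upper half-plane to the disc and turns \<open>1 - \<bar>z\<bar>\<^sup>2\<close> into the height
  divided by \<open>\<bar>\<zeta> + i\<bar>\<^sup>2 / 4\<close>; this is why \<open>ln (1 - \<bar>z\<bar>\<^sup>2)\<close> becomes the coordinate \<open>e\<close> up to a
  harmonic function.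
\<close>

lemma disc_coord_norm: "1 - (norm (disc_coord x e))\<^sup>2 = 4 * exp e / (norm (half_plane_pt x e + \<i>))\<^sup>2"
proof -
  have "(norm (half_plane_pt x e + \<i>))\<^sup>2 - (norm (half_plane_pt x e - \<i>))\<^sup>2 = 4 * exp e"
    unfolding half_plane_pt_def cmod_power2 by (simp add: power2_eq_square algebra_simps)
  moreover have "(norm (half_plane_pt x e + \<i>))\<^sup>2 \<noteq> 0" using half_plane_pt_plus_i_nonzero by simp
  ultimately show ?thesis unfolding disc_coord_def norm_divide power_divide
    by (simp add: field_simps)
qed

lemma disc_coord_in_disc: "norm (disc_coord x e) < 1"
proof -
  have "0 < 1 - (norm (disc_coord x e))\<^sup>2" unfolding disc_coord_norm using half_plane_pt_plus_i_nonzero[of x e] by simp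
  then show ?thesis by (simp add: power_less_one_iff)
qed

lemma disc_coord_inj: "disc_coord x e = disc_coord x' e' \<Longrightarrow> x = x' \<and> e = e'"
proof -
  assume "disc_coord x e = disc_coord x' e'"
  then have "(half_plane_pt x e - \<i>) * (half_plane_pt x' e' + \<i>) = (half_plane_pt x' e' - \<i>) * (half_plane_pt x e + \<i>)"
    unfolding disc_coord_def using half_plane_pt_plus_i_nonzero[of x e] half_plane_pt_plus_i_nonzero[of x' e'] by (simp add: frac_eq_eq)
  then have "2 * \<i> * half_plane_pt x e = 2 * \<i> * half_plane_pt x' e'" by (simp add: algebra_simps)
  then have "half_plane_pt x e = half_plane_pt x' e'" by simp
  then show ?thesis by (simp add: half_plane_pt_def)
qed

lemma disc_coord_surj:
  assumes "norm z < 1"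
  obtains x e where "z = disc_coord x e"
proof -
  define t where "t = \<i> * (1 + z) / (1 - z)"
  have z1: "1 - z \<noteq> 0" using assms by auto
  have "Im t = (1 - (norm z)\<^sup>2) / (norm (1 - z))\<^sup>2"
  proof -
    have "t = \<i> * ((1 + z) * cnj (1 - z)) / ((1 - z) * cnj (1 - z))"
      unfolding t_def using z1 mult_divide_mult_cancel_right[of "cnj (1 - z)" "\<i> * (1 + z)" "1 - z"]
      by (simp only: complex_cnj_zero_iff mult.assoc not_False_eq_True simp_thms)
    also have "(1 - z) * cnj (1 - z) = of_real ((norm (1 - z))\<^sup>2)" by (rule complex_norm_square[symmetric])
    finally have "Im t = Im (\<i> * ((1 + z) * cnj (1 - z))) / (norm (1 - z))\<^sup>2"
      by (simp only: Im_divide_of_real)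
    also have "Im (\<i> * ((1 + z) * cnj (1 - z))) = 1 - ((Re z)\<^sup>2 + (Im z)\<^sup>2)"
      by (simp add: power2_eq_square algebra_simps)
    finally show ?thesis unfolding cmod_power2[of z] .
  qed
  moreover have "(norm z)\<^sup>2 < 1" using assms by (simp add: power_less_one_iff)
  ultimately have "Im t > 0" using z1 by simp
  then have t: "t = half_plane_pt (Re t) (ln (Im t))" by (simp add: half_plane_pt_def complex_eq_iff)
  have "t - \<i> = 2 * \<i> * z / (1 - z)" "t + \<i> = 2 * \<i> / (1 - z)"
    unfolding t_def using z1 by (simp_all add: field_simps)
  then have "z = (t - \<i>) / (t + \<i>)" using z1 by simp
  then show ?thesis using t that unfolding disc_coord_def by metis
qed

lemma continuous_disc_coord: "continuous_on A (\<lambda>p. disc_coord (fst p) (snd p))"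
  unfolding disc_coord_def half_plane_pt_def Complex_eq
  using half_plane_pt_plus_i_nonzero by (intro continuous_intros) (auto simp: half_plane_pt_def Complex_eq)


text \<open>
  The derivative of the Cayley transform is \<open>2 i / (\<zeta> + i)\<^sup>2\<close>, and the factor \<open>exp e\<close> of the
  Jacobian comes from \<open>d\<zeta> = dx + i exp e de\<close>.
\<close>

lemma disc_integral_plane:
  fixes F :: "complex \<Rightarrow> real"
  assumes cont: "continuous_on (ball 0 1) F"
    and supp: "\<And>z. F z \<noteq> 0 \<Longrightarrow> \<exists>x e. \<bar>x\<bar> \<le> a \<and> \<bar>e\<bar> \<le> a \<and> z = disc_coord x e"
  shows "integrable lborel F"
    and "(LINT z|lborel. F z) = plane_int a (\<lambda>x e. F (disc_coord x e) * (4 * exp e / (norm (half_plane_pt x e + \<i>)) ^ 4))"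
proof -
  define P where "P = (\<lambda>p::real^2. Complex (p$1) (p$2))"
  define U where "U = (\<lambda>z. Re z *\<^sub>R axis 1 1 + Im z *\<^sub>R (axis 2 1 :: real^2))"
  have UP: "P (U z) = z" for z by (simp add: P_def U_def axis_def complex_eq_iff)
  have blU: "bounded_linear U" unfolding U_def by (intro bounded_linear_intros bounded_linear_Re bounded_linear_Im)
  define S :: "(real^2) set" where "S = cbox (\<chi> i. -a) (\<chi> i. a)"
  have S_iff: "p \<in> S \<longleftrightarrow> \<bar>p$1\<bar> \<le> a \<and> \<bar>p$2\<bar> \<le> a" for p
    unfolding S_def by (auto simp: mem_box_cart abs_le_iff forall_2)
  define \<phi> where "\<phi> = (\<lambda>p::real^2. U (disc_coord (p$1) (p$2)))"
  define d where "d = (\<lambda>p::real^2. 2 * \<i> / (half_plane_pt (p$1) (p$2) + \<i>)\<^sup>2)"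
  define \<phi>' where "\<phi>' = (\<lambda>p v::real^2. U (d p * Complex (v$1) (exp (p$2) * v$2)))"
  have der: "(\<phi> has_derivative \<phi>' p) (at p within A)" for p A
  proof -
    have dh: "((\<lambda>p::real^2. half_plane_pt (p$1) (p$2)) has_derivative (\<lambda>v. Complex (v$1) (exp (p$2) * v$2))) (at p within A)"
      unfolding half_plane_pt_def Complex_eq
      by (auto intro!: derivative_eq_intros bounded_linear_imp_has_derivative[OF bounded_linear_vec_nth])
    have "((\<lambda>z. (z - \<i>) / (z + \<i>)) has_field_derivative d p) (at (half_plane_pt (p$1) (p$2)))"
      using half_plane_pt_plus_i_nonzero[of "p$1" "p$2"] unfolding d_def
      by (auto intro!: derivative_eq_intros simp: power2_eq_square field_simps)
    then have "((\<lambda>z. (z - \<i>) / (z + \<i>)) has_derivative (*) (d p)) (at (half_plane_pt (p$1) (p$2)))"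
      by (simp add: has_field_derivative_def)
    from bounded_linear.has_derivative[OF blU has_derivative_compose[OF dh this]]
    show ?thesis unfolding \<phi>_def \<phi>'_def disc_coord_def by simp
  qed
  have inj: "inj_on \<phi> S"
  proof (rule inj_onI)
    fix p q assume "\<phi> p = \<phi> q"
    then have "disc_coord (p$1) (p$2) = disc_coord (q$1) (q$2)" unfolding \<phi>_def using UP by metis
    then show "p = q" using disc_coord_inj by (auto simp: vec_eq_iff forall_2)
  qed
  have det: "\<bar>det (matrix (\<phi>' p))\<bar> = 4 * exp (p$2) / (norm (half_plane_pt (p$1) (p$2) + \<i>)) ^ 4" for p
  proof -
    have "det (matrix (\<phi>' p)) = exp (p$2) * (norm (d p))\<^sup>2"
      unfolding cmod_power2
      by (simp add: det_2 matrix_def \<phi>'_def U_def axis_def power2_eq_square algebra_simps)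
    also have "(norm (d p))\<^sup>2 = 4 / (norm (half_plane_pt (p$1) (p$2) + \<i>)) ^ 4"
      unfolding d_def by (simp add: norm_divide norm_mult norm_power power_divide flip: power_mult)
    finally show ?thesis by simp
  qed
  define J where "J = (\<lambda>x e. 4 * exp e / (norm (half_plane_pt x e + \<i>)) ^ 4)"
  have contH: "cont2 (\<lambda>x e. F (disc_coord x e) * J x e)"
    unfolding J_def half_plane_pt_def Complex_eq
    by (intro continuous_intros continuous_on_compose2[OF cont continuous_disc_coord])
       (use disc_coord_in_disc half_plane_pt_plus_i_nonzero in \<open>auto simp: half_plane_pt_def Complex_eq\<close>)
  have contH': "continuous_on UNIV (\<lambda>p::real^2. F (disc_coord (p$1) (p$2)) * J (p$1) (p$2))"
  proof -
    have "continuous_on UNIV (\<lambda>p::real^2. (p$1, p$2))" by (intro continuous_intros)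
    from continuous_on_compose2[OF contH this] show ?thesis by simp
  qed
  define f :: "real^2 \<Rightarrow> real^1" where "f = (\<lambda>p. vec (F (P p)))"
  have pull: "\<bar>det (matrix (\<phi>' p))\<bar> *\<^sub>R f (\<phi> p) = vec (F (disc_coord (p$1) (p$2)) * J (p$1) (p$2))" for p
    unfolding det f_def J_def by (simp add: \<phi>_def UP vec_eq_iff)
  have ai: "(\<lambda>p. \<bar>det (matrix (\<phi>' p))\<bar> *\<^sub>R f (\<phi> p)) absolutely_integrable_on S"
    unfolding pull S_def
  proof (rule absolutely_integrable_continuous)
    have "continuous_on UNIV (\<lambda>p::real^2. \<chi> i::1. F (disc_coord (p$1) (p$2)) * J (p$1) (p$2))"
      by (intro continuous_on_vec_lambda contH')
    then show "continuous_on (cbox (\<chi> i. -a) (\<chi> i. a)) (\<lambda>p::real^2. vec (F (disc_coord (p$1) (p$2)) * J (p$1) (p$2)) :: real^1)"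
      unfolding vec_def using continuous_on_subset by blast
  qed
  have Sl: "S \<in> sets lebesgue" unfolding S_def by simp
  from has_absolute_integral_change_of_variables[OF Sl der inj, of f] ai
  have ai2: "f absolutely_integrable_on (\<phi> ` S)"
    and eq2: "integral (\<phi> ` S) f = integral S (\<lambda>p. \<bar>det (matrix (\<phi>' p))\<bar> *\<^sub>R f (\<phi> p))" by blast+
  have bl1: "bounded_linear (\<lambda>v::real^1. v $ 1)" by (rule bounded_linear_vec_nth)
  have ai3: "(\<lambda>p. F (P p)) absolutely_integrable_on (\<phi> ` S)"
    using absolutely_integrable_linear[OF ai2 bl1] by (simp add: f_def o_def)
  have eq3: "integral (\<phi> ` S) (\<lambda>p. F (P p)) = integral S (\<lambda>p. F (disc_coord (p$1) (p$2)) * J (p$1) (p$2))"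
  proof -
    have "integral (\<phi> ` S) ((\<lambda>v. v $ 1) \<circ> f) = integral (\<phi> ` S) f $ 1"
      using ai2 by (intro integral_linear bl1) (simp add: absolutely_integrable_on_def)
    also have "\<dots> = integral S ((\<lambda>v. v $ 1) \<circ> (\<lambda>p. \<bar>det (matrix (\<phi>' p))\<bar> *\<^sub>R f (\<phi> p)))"
      unfolding eq2 using ai by (intro integral_linear[symmetric] bl1) (simp add: absolutely_integrable_on_def)
    finally show ?thesis unfolding pull by (simp add: f_def o_def)
  qed
  have zero: "F (P p) = 0" if "p \<notin> \<phi> ` S" for p
  proof (rule ccontr)
    assume "F (P p) \<noteq> 0"
    then obtain x e where xe: "\<bar>x\<bar> \<le> a" "\<bar>e\<bar> \<le> a" "P p = disc_coord x e" using supp by blast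
    define q :: "real^2" where "q = U (Complex x e)"
    have q: "q$1 = x" "q$2 = e" by (simp_all add: q_def U_def axis_def)
    have "q \<in> S" unfolding S_iff q using xe by simp
    moreover have "\<phi> q = p"
    proof -
      have "\<phi> q = U (P p)" unfolding \<phi>_def q xe(3) ..
      also have "\<dots> = p" by (simp add: U_def P_def vec_eq_iff forall_2 axis_def)
      finally show ?thesis .
    qed
    ultimately show False using that by blast
  qed
  have Fm: "F \<in> borel_measurable borel"
  proof -
    have "(\<lambda>z. indicator (ball 0 1) z *\<^sub>R F z) \<in> borel_measurable borel"
      by (rule borel_measurable_continuous_on_indicator[OF _ cont]) simp
    moreover have "(\<lambda>z. indicator (ball 0 1) z *\<^sub>R F z) = F"
    proof
      fix z show "indicator (ball 0 1) z *\<^sub>R F z = F z"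
        using supp[of z] disc_coord_in_disc by (cases "F z = 0") (auto simp: indicator_def)
    qed
    ultimately show ?thesis by simp
  qed
  have Pm: "P \<in> borel_measurable lborel"
  proof -
    have "continuous_on UNIV P" unfolding P_def Complex_eq by (intro continuous_intros)
    then show ?thesis by (simp add: borel_measurable_continuous_onI)
  qed
  have FPm: "(\<lambda>p. F (P p)) \<in> borel_measurable lborel" using Fm Pm by (rule measurable_compose[rotated])
  have ind: "(\<lambda>p. indicator (\<phi> ` S) p *\<^sub>R F (P p)) = (\<lambda>p. F (P p))"
    using zero by (auto simp: indicator_def fun_eq_iff)
  have intl: "integrable lebesgue (\<lambda>p. F (P p))"
    using ai3 unfolding set_integrable_def ind .
  then have il: "integrable lborel (\<lambda>p. F (P p))"
    using integrable_completion[OF FPm] by simp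
  have D: "lborel = distr (lborel :: (real^2) measure) borel P" unfolding P_def by (rule lborel_real2_complex)
  show "integrable lborel F"
    by (subst D, subst integrable_distr_eq) (use Fm Pm il in auto)
  have "(LINT z|lborel. F z) = (LINT p|lborel. F (P p))"
    by (subst D, subst integral_distr) (use Fm Pm in auto)
  also have "\<dots> = (LINT p|lebesgue. F (P p))" by (rule integral_completion[OF FPm, symmetric])
  also have "\<dots> = integral (\<phi> ` S) (\<lambda>p. F (P p))"
    using set_lebesgue_integral_eq_integral(2)[OF ai3] unfolding set_lebesgue_integral_def ind by simp
  also note eq3
  also have "integral S (\<lambda>p. F (disc_coord (p$1) (p$2)) * J (p$1) (p$2)) = plane_int a (\<lambda>x e. F (disc_coord x e) * J x e)"
  proof -
    let ?H = "\<lambda>q. F (disc_coord (fst q) (snd q)) * J (fst q) (snd q)"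
    let ?Q = "\<lambda>p::real^2. (p$1, p$2)"
    let ?C = "cbox (-a,-a) (a,a) :: (real \<times> real) set"
    have Qm: "?Q \<in> borel_measurable lborel"
    proof -
      have "continuous_on UNIV ?Q" by (intro continuous_intros)
      then show ?thesis by (simp add: borel_measurable_continuous_onI)
    qed
    have Hm: "(\<lambda>q. indicator ?C q *\<^sub>R ?H q) \<in> borel_measurable borel"
      by (rule borel_measurable_continuous_on_indicator) (use contH continuous_on_subset in auto)
    have "plane_int a (\<lambda>x e. F (disc_coord x e) * J x e) = (LINT q:?C|lborel. ?H q)"
      unfolding plane_int_def
    proof (rule set_borel_integral_eq_integral(2)[symmetric])
      show "set_integrable lborel ?C ?H" unfolding set_integrable_def
        by (rule borel_integrable_compact[OF compact_cbox continuous_on_subset[OF contH]]) simp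
    qed
    also have "\<dots> = (LINT p|lborel. indicator ?C (?Q p) *\<^sub>R ?H (?Q p))"
      unfolding set_lebesgue_integral_def
      by (subst lborel_real2_prod, subst integral_distr) (use Hm Qm in auto)
    also have "\<dots> = (LINT p:S|lborel. F (disc_coord (p$1) (p$2)) * J (p$1) (p$2))"
      unfolding set_lebesgue_integral_def
      by (rule Bochner_Integration.integral_cong) (auto simp: indicator_def S_iff abs_le_iff)
    also have "\<dots> = integral S (\<lambda>p. F (disc_coord (p$1) (p$2)) * J (p$1) (p$2))"
    proof (rule set_borel_integral_eq_integral(2))
      show "set_integrable lborel S (\<lambda>p. F (disc_coord (p$1) (p$2)) * J (p$1) (p$2))"
        unfolding set_integrable_def S_def
        by (rule borel_integrable_compact[OF compact_cbox continuous_on_subset[OF contH']]) simp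
    qed
    finally show ?thesis by simp
  qed
  finally show "(LINT z|lborel. F z) = plane_int a (\<lambda>x e. F (disc_coord x e) * (4 * exp e / (norm (half_plane_pt x e + \<i>)) ^ 4))"
    unfolding J_def .
qed

section \<open>The logarithm of the height on the disc\<close>

lemma half_plane_pt_vector_deriv_x: "((\<lambda>x. half_plane_pt x e) has_vector_derivative 1) (at x)"
  unfolding half_plane_pt_def Complex_eq by (auto intro!: derivative_eq_intros)

lemma half_plane_pt_vector_deriv_e: "((\<lambda>e. half_plane_pt x e) has_vector_derivative \<i> * of_real (exp e)) (at e)"
proof -
  have "(exp has_vector_derivative exp e) (at e)"
    using DERIV_exp[of e] by (simp add: has_real_derivative_iff_has_vector_derivative)
  then have "((\<lambda>e. of_real (exp e) :: complex) has_vector_derivative of_real (exp e)) (at e)"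
    by (rule bounded_linear.has_vector_derivative[OF bounded_linear_of_real])
  then have "((\<lambda>e. of_real x + \<i> * of_real (exp e)) has_vector_derivative 0 + \<i> * of_real (exp e)) (at e)"
    by (intro has_vector_derivative_add has_vector_derivative_const has_vector_derivative_mult_right)
  then show ?thesis unfolding half_plane_pt_def Complex_eq by simp
qed

text \<open>
  If \<open>f = exp h\<close>, this is the logarithm of \<open>\<bar>f z\<bar>\<^sup>2 (1 - \<bar>z\<bar>\<^sup>2)\<close>.
\<close>

definition logheight :: "(complex \<Rightarrow> complex) \<Rightarrow> complex \<Rightarrow> real" where
  "logheight h z = 2 * Re (h z) + ln (1 - (norm z)\<^sup>2)"

text \<open>
  The factor \<open>(1 - \<bar>z\<bar>\<^sup>2)\<^sup>-\<^sup>2\<close> is the density of the invariant area, so the integral of this function over the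
  plane is the integral of \<open>q (logheight h z)\<close> over the hyperbolic plane.
\<close>

definition disc_density :: "(complex \<Rightarrow> complex) \<Rightarrow> (real \<Rightarrow> real) \<Rightarrow> complex \<Rightarrow> real" where
  "disc_density h q z = (if norm z < 1 then q (logheight h z) / (1 - (norm z)\<^sup>2)\<^sup>2 else 0)"

context
  fixes h :: "complex \<Rightarrow> complex" and C :: real
  assumes hol: "h holomorphic_on ball 0 1" and bound: "\<And>z. norm z < 1 \<Longrightarrow> Re (h z) \<le> C"
begin

text \<open>
  In half-plane coordinates the logarithm of the height is \<open>e\<close> plus a harmonic function, and \<open>e\<close> has
  hyperbolic Laplacian \<open>-1\<close>. As \<open>Re h\<close> is bounded above, it tends to \<open>-\<infinity>\<close> at the boundary of the disc.
\<close>

lemma torsion_plane_disc: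
  "\<exists>Vx Ve Vxx Vee. torsion_plane (\<lambda>x e. logheight h (disc_coord x e)) Vx Ve Vxx Vee"
proof -
  define P where "P = {\<zeta>::complex. Im \<zeta> > 0}"
  have P_open: "open P" unfolding P_def by (rule open_halfspace_Im_gt)
  have hpP: "half_plane_pt x e \<in> P" for x e by (simp add: P_def half_plane_pt_def)
  define H where "H = (\<lambda>\<zeta>. h ((\<zeta> - \<i>) / (\<zeta> + \<i>)))"
  have H_hol: "H holomorphic_on P"
  proof -
    have eq: "\<zeta> = half_plane_pt (Re \<zeta>) (ln (Im \<zeta>))" if "\<zeta> \<in> P" for \<zeta>
      using that by (simp add: P_def half_plane_pt_def complex_eq_iff)
    have n0: "\<zeta> + \<i> \<noteq> 0" if "\<zeta> \<in> P" for \<zeta> using eq[OF that] half_plane_pt_plus_i_nonzero by metis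
    have "(\<zeta> - \<i>) / (\<zeta> + \<i>) \<in> ball 0 1" if "\<zeta> \<in> P" for \<zeta>
    proof -
      have "(\<zeta> - \<i>) / (\<zeta> + \<i>) = disc_coord (Re \<zeta>) (ln (Im \<zeta>))"
        unfolding disc_coord_def eq[OF that, symmetric] ..
      then show ?thesis using disc_coord_in_disc by simp
    qed
    moreover have "(\<lambda>\<zeta>. (\<zeta> - \<i>) / (\<zeta> + \<i>)) holomorphic_on P"
      using n0 by (auto intro!: holomorphic_intros)
    ultimately have "(h \<circ> (\<lambda>\<zeta>. (\<zeta> - \<i>) / (\<zeta> + \<i>))) holomorphic_on P"
      by (intro holomorphic_on_compose holomorphic_on_subset[OF hol]) auto
    then show ?thesis by (simp add: H_def o_def)
  qed
  define k where "k = deriv H"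
  have k_hol: "k holomorphic_on P" unfolding k_def by (rule holomorphic_deriv[OF H_hol P_open])
  define k' where "k' = deriv k"
  have k'_hol: "k' holomorphic_on P" unfolding k'_def by (rule holomorphic_deriv[OF k_hol P_open])
  have dx: "((\<lambda>x. K (half_plane_pt x e)) has_vector_derivative deriv K (half_plane_pt x e)) (at x)"
    and de: "((\<lambda>e. K (half_plane_pt x e)) has_vector_derivative \<i> * of_real (exp e) * deriv K (half_plane_pt x e)) (at e)"
    if "K holomorphic_on P" for K x e
  proof -
    have d: "(K has_field_derivative deriv K (half_plane_pt x e)) (at (half_plane_pt x e))"
      using that P_open hpP by (rule holomorphic_derivI)
    show "((\<lambda>x. K (half_plane_pt x e)) has_vector_derivative deriv K (half_plane_pt x e)) (at x)"
      using field_vector_diff_chain_at[OF half_plane_pt_vector_deriv_x d] by (simp add: o_def)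
    show "((\<lambda>e. K (half_plane_pt x e)) has_vector_derivative \<i> * of_real (exp e) * deriv K (half_plane_pt x e)) (at e)"
      using field_vector_diff_chain_at[OF half_plane_pt_vector_deriv_e d] by (simp add: o_def)
  qed
  have re: "((\<lambda>t. Re (q t)) has_real_derivative Re d) (at t)" and im: "((\<lambda>t. Im (q t)) has_real_derivative Im d) (at t)"
    if "(q has_vector_derivative d) (at t)" for q d t
    using bounded_linear.has_vector_derivative[OF bounded_linear_Re that]
      bounded_linear.has_vector_derivative[OF bounded_linear_Im that]
    by (simp_all add: has_real_derivative_iff_has_vector_derivative)
  have H_x: "((\<lambda>x. Re (H (half_plane_pt x e))) has_real_derivative Re (k (half_plane_pt x e))) (at x)" for x e
    unfolding k_def by (rule re[OF dx[OF H_hol]])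
  have H_e: "((\<lambda>e. Re (H (half_plane_pt x e))) has_real_derivative - (exp e * Im (k (half_plane_pt x e)))) (at e)" for x e
    using re[OF de[OF H_hol]] unfolding k_def by simp
  have k_x: "((\<lambda>x. Re (k (half_plane_pt x e))) has_real_derivative Re (k' (half_plane_pt x e))) (at x)" for x e
    unfolding k'_def by (rule re[OF dx[OF k_hol]])
  have k_e: "((\<lambda>e. Im (k (half_plane_pt x e))) has_real_derivative exp e * Re (k' (half_plane_pt x e))) (at e)" for x e
    using im[OF de[OF k_hol]] unfolding k'_def by simp
  have chp: "continuous_on UNIV (\<lambda>p. half_plane_pt (fst p) (snd p))"
    unfolding half_plane_pt_def Complex_eq by (intro continuous_intros)
  have cK: "continuous_on UNIV (\<lambda>p. K (half_plane_pt (fst p) (snd p)))" if "K holomorphic_on P" for K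
    by (rule continuous_on_compose2[OF holomorphic_on_imp_continuous_on[OF that] chp]) (use hpP in auto)
  define N where "N = (\<lambda>x e::real. x\<^sup>2 + (exp e + 1)\<^sup>2)"
  have N0: "N x e > 0" for x e
  proof -
    have "0 < exp e + 1" by (simp add: add_pos_pos)
    then have "0 < (exp e + 1)\<^sup>2" by simp
    then show ?thesis unfolding N_def by (rule add_nonneg_pos[OF zero_le_power2])
  qed
  have N0': "N x e \<noteq> 0" for x e using N0[of x e] by simp
  have V_eq: "logheight h (disc_coord x e) = 2 * Re (H (half_plane_pt x e)) + ln 4 + e - ln (N x e)" for x e
  proof -
    have "ln (1 - (norm (disc_coord x e))\<^sup>2) = ln (4 * exp e / N x e)"
      unfolding disc_coord_norm norm_half_plane_pt_plus_i N_def ..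
    also have "\<dots> = ln 4 + e - ln (N x e)" using N0[of x e] by (simp add: ln_div ln_mult)
    finally show ?thesis unfolding logheight_def by (simp add: H_def disc_coord_def)
  qed
  have cN: "continuous_on UNIV (\<lambda>p. N (fst p) (snd p))" unfolding N_def by (intro continuous_intros)
  define Vx where "Vx = (\<lambda>x e. 2 * Re (k (half_plane_pt x e)) - 2 * x / N x e)"
  define Ve where "Ve = (\<lambda>x e. - (2 * exp e * Im (k (half_plane_pt x e))) + 1 - 2 * (exp e + 1) * exp e / N x e)"
  define Vxx where "Vxx = (\<lambda>x e. 2 * Re (k' (half_plane_pt x e)) - (2 / N x e - 4 * x\<^sup>2 / (N x e)\<^sup>2))"
  define Vee where "Vee = (\<lambda>x e. - (2 * exp e * Im (k (half_plane_pt x e)) + 2 * (exp e)\<^sup>2 * Re (k' (half_plane_pt x e)))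
      - ((4 * (exp e)\<^sup>2 + 2 * exp e) / N x e - (2 * (exp e + 1) * exp e)\<^sup>2 / (N x e)\<^sup>2))"
  have N_x: "((\<lambda>x. N x e) has_real_derivative 2 * x) (at x)" for x e
    unfolding N_def by (auto intro!: derivative_eq_intros)
  have N_e: "((\<lambda>e. N x e) has_real_derivative 2 * (exp e + 1) * exp e) (at e)" for x e
    unfolding N_def by (auto intro!: derivative_eq_intros)
  have lnN_x: "((\<lambda>x. ln (N x e)) has_real_derivative 2 * x / N x e) (at x)" for x e
    using DERIV_chain2[OF DERIV_ln[OF N0] N_x] by (simp add: divide_inverse mult.commute)
  have lnN_e: "((\<lambda>e. ln (N x e)) has_real_derivative 2 * (exp e + 1) * exp e / N x e) (at e)" for x e
    using DERIV_chain2[OF DERIV_ln[OF N0] N_e] by (simp add: divide_inverse mult.commute)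
  have "torsion_plane (\<lambda>x e. logheight h (disc_coord x e)) Vx Ve Vxx Vee"
  proof
    fix x e :: real
    show "((\<lambda>x. logheight h (disc_coord x e)) has_real_derivative Vx x e) (at x)"
    proof -
      have "((\<lambda>x. 2 * Re (H (half_plane_pt x e)) + ln 4 + e - ln (N x e)) has_real_derivative
          2 * Re (k (half_plane_pt x e)) + 0 + 0 - 2 * x / N x e) (at x)"
        by (intro DERIV_diff DERIV_add DERIV_cmult DERIV_const H_x lnN_x)
      then show ?thesis unfolding V_eq Vx_def by simp
    qed
    show "((\<lambda>e. logheight h (disc_coord x e)) has_real_derivative Ve x e) (at e)"
    proof -
      have "((\<lambda>e. 2 * Re (H (half_plane_pt x e)) + ln 4 + e - ln (N x e)) has_real_derivative
          2 * (- (exp e * Im (k (half_plane_pt x e)))) + 0 + 1 - 2 * (exp e + 1) * exp e / N x e) (at e)"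
        by (intro DERIV_diff DERIV_add DERIV_cmult DERIV_const DERIV_ident H_e lnN_e)
      then show ?thesis unfolding V_eq Ve_def by (simp add: mult.assoc)
    qed
    show "((\<lambda>x. Vx x e) has_real_derivative Vxx x e) (at x)"
    proof -
      have "((\<lambda>x. 2 * x / N x e) has_real_derivative (2 * N x e - 2 * x * (2 * x)) / (N x e * N x e)) (at x)"
        by (rule DERIV_divide[OF _ N_x N0']) (auto intro!: derivative_eq_intros)
      moreover have "(2 * N x e - 2 * x * (2 * x)) / (N x e * N x e) = 2 / N x e - 4 * x\<^sup>2 / (N x e)\<^sup>2"
        using N0'[of x e] by (simp add: field_simps power2_eq_square)
      ultimately have "((\<lambda>x. 2 * x / N x e) has_real_derivative 2 / N x e - 4 * x\<^sup>2 / (N x e)\<^sup>2) (at x)"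
        by (simp only:)
      then show ?thesis unfolding Vx_def Vxx_def
        by (intro DERIV_diff DERIV_cmult k_x)
    qed
    show "((\<lambda>e. Ve x e) has_real_derivative Vee x e) (at e)"
    proof -
      have "((\<lambda>e. 2 * (exp e + 1) * exp e / N x e) has_real_derivative
          ((4 * (exp e)\<^sup>2 + 2 * exp e) * N x e - 2 * (exp e + 1) * exp e * (2 * (exp e + 1) * exp e)) / (N x e * N x e)) (at e)"
      proof (rule DERIV_divide[OF _ N_e N0'])
        show "((\<lambda>e. 2 * (exp e + 1) * exp e) has_real_derivative 4 * (exp e)\<^sup>2 + 2 * exp e) (at e)"
          by (auto intro!: derivative_eq_intros simp: power2_eq_square algebra_simps)
      qed
      moreover have "((4 * (exp e)\<^sup>2 + 2 * exp e) * N x e - 2 * (exp e + 1) * exp e * (2 * (exp e + 1) * exp e)) / (N x e * N x e)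
         = (4 * (exp e)\<^sup>2 + 2 * exp e) / N x e - (2 * (exp e + 1) * exp e)\<^sup>2 / (N x e)\<^sup>2"
        using N0'[of x e] by (simp add: diff_divide_distrib power2_eq_square)
      moreover have "((\<lambda>e. 2 * exp e * Im (k (half_plane_pt x e))) has_real_derivative
          2 * exp e * Im (k (half_plane_pt x e)) + 2 * (exp e)\<^sup>2 * Re (k' (half_plane_pt x e))) (at e)"
      proof -
        have "((\<lambda>e. 2 * exp e) has_real_derivative 2 * exp e) (at e)" by (intro DERIV_cmult DERIV_exp)
        from DERIV_mult[OF this k_e] show ?thesis by (simp add: power2_eq_square algebra_simps)
      qed
      ultimately have "((\<lambda>e. - (2 * exp e * Im (k (half_plane_pt x e))) + 1 - 2 * (exp e + 1) * exp e / N x e) has_real_derivative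
         - (2 * exp e * Im (k (half_plane_pt x e)) + 2 * (exp e)\<^sup>2 * Re (k' (half_plane_pt x e))) + 0
      - ((4 * (exp e)\<^sup>2 + 2 * exp e) / N x e - (2 * (exp e + 1) * exp e)\<^sup>2 / (N x e)\<^sup>2)) (at e)"
        by (intro DERIV_diff DERIV_add DERIV_minus DERIV_const) simp_all
      then show ?thesis unfolding Ve_def Vee_def by simp
    qed
    show "exp (2 * e) * Vxx x e + Vee x e - Ve x e = - 1"
    proof -
      define y where "y = exp e"
      have y2: "exp (2 * e) = y\<^sup>2" unfolding y_def by (simp add: power2_eq_square exp_add[symmetric])
      have N: "N x e = x\<^sup>2 + (y + 1)\<^sup>2" unfolding N_def y_def ..
      have "y\<^sup>2 * (2 / N x e - 4 * x\<^sup>2 / (N x e)\<^sup>2) + ((4 * y\<^sup>2 + 2 * y) / N x e - (2 * (y + 1) * y)\<^sup>2 / (N x e)\<^sup>2)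
          - 2 * (y + 1) * y / N x e
        = 4 * y\<^sup>2 / N x e - 4 * y\<^sup>2 * (x\<^sup>2 + (y + 1)\<^sup>2) / (N x e)\<^sup>2"
        using N0'[of x e] by (simp add: field_simps) (simp add: power2_eq_square algebra_simps)
      also have "\<dots> = 0" unfolding N[symmetric] using N0'[of x e] by (simp add: power2_eq_square)
      finally show ?thesis
        unfolding Vxx_def Vee_def Ve_def y2 y_def[symmetric] by (simp add: algebra_simps)
    qed
  next
    show "cont2 (\<lambda>x e. logheight h (disc_coord x e))" unfolding V_eq
      by (intro continuous_intros cK H_hol cN) (use N0' in auto)
    show "cont2 Vx" unfolding Vx_def by (intro continuous_intros cK k_hol cN) (use N0' in auto)
    show "cont2 Ve" unfolding Ve_def by (intro continuous_intros cK k_hol cN) (use N0' in auto)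
    show "cont2 Vxx" unfolding Vxx_def by (intro continuous_intros cK k'_hol cN) (use N0' in auto)
    show "cont2 Vee" unfolding Vee_def by (intro continuous_intros cK k_hol k'_hol cN) (use N0' in auto)
  next
    fix s :: real
    define r where "r = exp (s - 2 * C)"
    have r: "r > 0" by (simp add: r_def)
    \<comment> \<open>here \<open>r\<close> is a lower bound for \<open>1 - \<bar>z\<bar>\<^sup>2\<close> on the superlevel set\<close>
    have *: "\<bar>x\<bar> \<le> 4 / r \<and> \<bar>e\<bar> \<le> \<bar>ln (4 / r)\<bar>" if "s \<le> logheight h (disc_coord x e)" for x e
    proof -
      let ?y = "exp e"
      have "s - 2 * C \<le> ln (1 - (norm (disc_coord x e))\<^sup>2)"
        using that bound[OF disc_coord_in_disc[of x e]] unfolding logheight_def by simp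
      also have "\<dots> = ln (4 * ?y / N x e)" unfolding disc_coord_norm norm_half_plane_pt_plus_i N_def ..
      finally have "r \<le> 4 * ?y / N x e"
        unfolding r_def using N0[of x e] by (simp add: ln_ge_iff)
      then have rN: "r * N x e \<le> 4 * ?y" using N0[of x e] by (simp add: pos_le_divide_eq)
      have y0: "?y > 0" by simp
      have N1: "1 \<le> N x e" "?y * ?y \<le> N x e" "x\<^sup>2 \<le> N x e"
        unfolding N_def using y0 by (auto simp: power2_eq_square algebra_simps)
      have rT: "r * T \<le> 4 * ?y" if "T \<le> N x e" for T
        using order_trans[OF mult_left_mono[OF that less_imp_le[OF r]] rN] .
      have y1: "r \<le> 4 * ?y" using rT[OF N1(1)] by simp
      have "r * (?y * ?y) \<le> 4 * ?y" by (rule rT[OF N1(2)])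
      then have "r * ?y \<le> 4" using y0 by (simp add: mult.assoc[symmetric])
      then have y2: "?y \<le> 4 / r" using r by (simp add: field_simps)
      have "e \<le> ln (4 / r)" using y2 r by (simp add: ln_ge_iff)
      moreover have "- ln (4 / r) \<le> e"
      proof -
        have "ln (r / 4) \<le> ln ?y" using y1 r by (subst ln_le_cancel_iff) auto
        moreover have "ln (r / 4) = - ln (4 / r)" using r by (simp add: ln_div)
        ultimately show ?thesis by simp
      qed
      moreover have "x\<^sup>2 \<le> (4 / r)\<^sup>2"
      proof -
        have "r * x\<^sup>2 \<le> 4 * ?y" by (rule rT[OF N1(3)])
        then have "r * x\<^sup>2 \<le> 4 * (4 / r)" using y2 by linarith
        then show ?thesis using r by (simp add: field_simps power2_eq_square)
      qed
      then have "\<bar>x\<bar> \<le> 4 / r" using r by (metis abs_le_square_iff abs_of_pos divide_pos_pos zero_less_numeral)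
      ultimately show ?thesis by linarith
    qed
    show "\<exists>a>0. \<forall>x e. s \<le> logheight h (disc_coord x e) \<longrightarrow> \<bar>x\<bar> < a \<and> \<bar>e\<bar> < a"
      by (rule exI[of _ "4 / r + \<bar>ln (4 / r)\<bar> + 1"]) (use * r in \<open>force intro: add_nonneg_pos\<close>)
  qed
  then show ?thesis by blast
qed

text \<open>
  The constant drops from \<open>4 \<pi>\<close> to \<open>\<pi>\<close> because \<open>exp (-e) dx de\<close> is
  \<open>4 (1 - \<bar>z\<bar>\<^sup>2)\<^sup>-\<^sup>2\<close> times the Lebesgue measure of the disc.
\<close>

lemma disc_superlevel_inequality:
  assumes g: "continuous_on UNIV g" "\<And>t. g t \<ge> 0" and supp: "\<And>t. t \<le> c \<or> d \<le> t \<Longrightarrow> g t = 0"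
    and cd: "c < d" and top: "norm z1 < 1" "d < logheight h z1"
    and G: "\<And>t. (G has_real_derivative g t) (at t)" and Gc: "G c = 0"
  shows "integrable lborel (disc_density h g)" "integrable lborel (disc_density h G)"
    "(LINT z|lborel. disc_density h g z) \<ge> (LINT z|lborel. disc_density h G z) + pi * G d"
proof -
  obtain Vx Ve Vxx Vee where "torsion_plane (\<lambda>x e. logheight h (disc_coord x e)) Vx Ve Vxx Vee"
    using torsion_plane_disc by blast
  then interpret T: torsion_plane "\<lambda>x e. logheight h (disc_coord x e)" Vx Ve Vxx Vee .
  obtain a where a: "a > 0" "\<And>x e. c - 1 \<le> logheight h (disc_coord x e) \<Longrightarrow> \<bar>x\<bar> < a \<and> \<bar>e\<bar> < a"
    using T.proper[of "c - 1"] by blast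
  obtain x1 e1 where z1: "z1 = disc_coord x1 e1" using disc_coord_surj[OF top(1)] by blast
  have G_cont: "continuous_on UNIV G"
    using G by (meson DERIV_isCont continuous_at_imp_continuous_on)
  have G0: "G t = 0" if "t \<le> c" for t
  proof -
    have i1: "(g has_integral G c - G t) {t..c}" by (rule FTC_real[OF G that])
    have i2: "(g has_integral 0) {t..c}" by (rule has_integral_is_0) (use supp in auto)
    show ?thesis using has_integral_unique[OF i1 i2] Gc by simp
  qed
  have main: "integrable lborel (disc_density h q) \<and>
     (LINT z|lborel. disc_density h q z) = plane_int a (\<lambda>x e. q (logheight h (disc_coord x e)) * exp (-e)) / 4"
    if q: "continuous_on UNIV q" "\<And>t. t \<le> c \<Longrightarrow> q t = 0" for q
  proof -
    have sq: "1 - (norm z)\<^sup>2 \<noteq> 0" "(1 - (norm z)\<^sup>2)\<^sup>2 \<noteq> 0" if "z \<in> ball 0 1" for z :: complex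
    proof -
      have "(norm z)\<^sup>2 < 1" using that by (simp add: power_less_one_iff)
      then show "1 - (norm z)\<^sup>2 \<noteq> 0" "(1 - (norm z)\<^sup>2)\<^sup>2 \<noteq> 0" by auto
    qed
    have "continuous_on (ball 0 1) h" using hol by (rule holomorphic_on_imp_continuous_on)
    then have "continuous_on (ball 0 1) (logheight h)" unfolding logheight_def
      by (intro continuous_intros ballI sq(1))
    then have "continuous_on (ball 0 1) (\<lambda>z. q (logheight h z))"
      by (rule continuous_on_compose2[OF q(1)]) auto
    then have "continuous_on (ball 0 1) (\<lambda>z. q (logheight h z) / (1 - (norm z)\<^sup>2)\<^sup>2)"
      by (intro continuous_intros ballI sq(2))
    then have c: "continuous_on (ball 0 1) (disc_density h q)"
      by (subst continuous_on_cong[OF refl]) (auto simp: disc_density_def)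
    have s: "\<exists>x e. \<bar>x\<bar> \<le> a \<and> \<bar>e\<bar> \<le> a \<and> z = disc_coord x e" if "disc_density h q z \<noteq> 0" for z
    proof -
      have z: "norm z < 1" "q (logheight h z) \<noteq> 0" using that by (auto simp: disc_density_def split: if_splits)
      obtain x e where xe: "z = disc_coord x e" using disc_coord_surj[OF z(1)] by blast
      have "c - 1 \<le> logheight h z" using q(2)[of "logheight h z"] z(2) by linarith
      then show ?thesis using a(2) xe by (metis less_imp_le)
    qed
    have J: "disc_density h q (disc_coord x e) * (4 * exp e / (norm (half_plane_pt x e + \<i>)) ^ 4)
        = (1/4) * (q (logheight h (disc_coord x e)) * exp (-e))" for x e
    proof -
      define M where "M = (norm (half_plane_pt x e + \<i>))\<^sup>2"
      have M: "M > 0" unfolding M_def using half_plane_pt_plus_i_nonzero by simp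
      have M4: "(norm (half_plane_pt x e + \<i>)) ^ 4 = M\<^sup>2" unfolding M_def by (simp flip: power_mult)
      show ?thesis unfolding M4 disc_density_def disc_coord_norm M_def[symmetric]
        using M disc_coord_in_disc[of x e] by (simp add: field_simps power2_eq_square exp_minus)
    qed
    show ?thesis using disc_integral_plane[OF c s] unfolding J plane_int_cmult by simp
  qed
  have g0: "g t = 0" if "t \<le> c" for t using supp that by blast
  show "integrable lborel (disc_density h g)" using main[OF g(1) g0] by blast
  show "integrable lborel (disc_density h G)" using main[OF G_cont G0] by blast
  have "plane_int a (\<lambda>x e. g (logheight h (disc_coord x e)) * exp (-e)) \<ge>
      plane_int a (\<lambda>x e. G (logheight h (disc_coord x e)) * exp (-e)) + 4 * pi * G d"
    by (rule T.superlevel_inequality[OF g supp cd _ G Gc a]) (use top(2) z1 in auto)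
  then show "(LINT z|lborel. disc_density h g z) \<ge> (LINT z|lborel. disc_density h G z) + pi * G d"
    using main[OF g(1) g0] main[OF G_cont G0] by simp
qed

end

section \<open>Integrability and passage to the limit\<close>

text \<open>
  The set where \<open>1 - \<bar>z\<bar>\<^sup>2 \<le> 2\<^sup>-\<^sup>n\<close> has area \<open>\<pi> 2\<^sup>-\<^sup>n\<close>, so for \<open>\<gamma> \<ge> 0\<close> the integral is dominated by a geometric series
  of ratio \<open>2 powr (\<gamma> - 1)\<close>. A negative \<open>\<gamma>\<close> gives a smaller weight than \<open>\<gamma> = 0\<close>.
\<close>

lemma nn_integral_disc_weight:
  assumes "\<gamma> < 1"
  shows "(\<integral>\<^sup>+z. ennreal (indicator (ball 0 1) z * (1 - (norm z)\<^sup>2) powr (-\<gamma>)) \<partial>(lborel :: complex measure)) < \<infinity>"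
proof -
  define \<delta> where "\<delta> = max \<gamma> 0"
  have \<delta>: "0 \<le> \<delta>" "\<delta> < 1" "\<gamma> \<le> \<delta>" using assms by (auto simp: \<delta>_def)
  define B where "B = (\<lambda>n::nat. {z::complex. norm z < 1 \<and> 1 - (norm z)\<^sup>2 \<le> (1/2) ^ n})"
  have B_eq: "B n = ball 0 1 - ball 0 (sqrt (1 - (1/2) ^ n))" for n
  proof -
    have "(1/2::real) ^ n \<le> 1" by (simp add: power_le_one)
    then have key: "1 - (norm z)\<^sup>2 \<le> (1/2) ^ n \<longleftrightarrow> \<not> norm z < sqrt (1 - (1/2) ^ n)" for z :: complex
    proof -
      have "sqrt (1 - (1/2) ^ n) \<le> norm z \<longleftrightarrow> sqrt (1 - (1/2) ^ n) \<le> sqrt ((norm z)\<^sup>2)" by simp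
      also have "\<dots> \<longleftrightarrow> 1 - (1/2) ^ n \<le> (norm z)\<^sup>2" by (rule real_sqrt_le_iff)
      finally show ?thesis by (simp add: not_less) linarith
    qed
    show ?thesis
      by (rule set_eqI) (simp only: B_def mem_Collect_eq Diff_iff mem_ball dist_0_norm key)
  qed
  have B_meas: "B n \<in> sets lborel" for n unfolding B_eq by simp
  have B_em: "emeasure lborel (B n) = ennreal (pi * (1/2) ^ n)" for n
  proof -
    have le1: "(1/2::real) ^ n \<le> 1" by (simp add: power_le_one)
    have r: "0 \<le> sqrt (1 - (1/2) ^ n)" using le1 by simp
    have sub: "ball 0 (sqrt (1 - (1/2) ^ n)) \<subseteq> (ball 0 1 :: complex set)"
      by (intro subset_ball) (simp add: real_sqrt_le_1_iff)
    have "emeasure lborel (B n) = emeasure lborel (ball 0 1 :: complex set) - emeasure lborel (ball 0 (sqrt (1 - (1/2) ^ n)) :: complex set)"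
      unfolding B_eq by (rule emeasure_Diff) (use sub in \<open>auto simp: emeasure_ball[OF r]\<close>)
    also have "\<dots> = ennreal pi - ennreal (pi * (1 - (1/2) ^ n))"
      using le1 by (subst emeasure_ball, simp, subst emeasure_ball[OF r]) (simp add: unit_ball_vol_2)
    also have "\<dots> = ennreal (pi * (1/2) ^ n)"
      using le1 by (subst ennreal_minus) (auto simp: algebra_simps)
    finally show ?thesis .
  qed
  define c where "c = (\<lambda>n::nat. (2 powr \<delta>) ^ Suc n)"
  have c0: "c n \<ge> 0" for n unfolding c_def by simp
  have pt: "ennreal (indicator (ball 0 1) z * (1 - (norm z)\<^sup>2) powr (-\<gamma>)) \<le> (\<Sum>n. ennreal (c n) * indicator (B n) z)" for z :: complex
  proof (cases "norm z < 1")
    case True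
    define \<rho> where "\<rho> = 1 - (norm z)\<^sup>2"
    have \<rho>: "0 < \<rho>" "\<rho> \<le> 1" using True by (auto simp: \<rho>_def power_less_one_iff)
    obtain N where N: "(1/2::real) ^ N < \<rho>" using real_arch_pow_inv[OF \<rho>(1), of "1/2"] by auto
    define k where "k = (LEAST n. (1/2::real) ^ n < \<rho>)"
    have k: "(1/2::real) ^ k < \<rho>" unfolding k_def using N by (rule LeastI)
    have "k \<noteq> 0" using k \<rho> by (intro notI) simp
    then obtain n where n: "k = Suc n" using not0_implies_Suc by blast
    have "\<not> (1/2::real) ^ n < \<rho>" using not_less_Least[of n "\<lambda>n. (1/2::real) ^ n < \<rho>"] n unfolding k_def by simp
    then have inB: "z \<in> B n" using True unfolding B_def \<rho>_def by simp
    have "\<rho> powr (-\<gamma>) \<le> \<rho> powr (-\<delta>)" using \<rho> \<delta> by (intro powr_mono') auto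
    also have "\<dots> \<le> ((1/2) ^ k) powr (-\<delta>)" using k \<delta> by (intro powr_mono2') auto
    also have "\<dots> = c n"
    proof -
      have "(1/2::real) ^ k = 2 powr (- real k)"
        by (simp add: powr_minus powr_realpow power_one_over inverse_eq_divide)
      then show ?thesis unfolding c_def n by (simp add: powr_powr powr_power algebra_simps del: power_Suc)
    qed
    finally have "ennreal (indicator (ball 0 1) z * \<rho> powr (-\<gamma>)) \<le> ennreal (c n) * indicator (B n) z"
      using True inB by (simp add: ennreal_leI)
    also have "\<dots> \<le> (\<Sum>n. ennreal (c n) * indicator (B n) z)"
    proof -
      define F where "F = (\<lambda>n. ennreal (c n) * indicator (B n) z)"
      have "sum F {n} \<le> suminf F" by (rule sum_le_suminf) auto
      then have "F n \<le> suminf F" by simp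
      then show ?thesis unfolding F_def .
    qed
    finally show ?thesis unfolding \<rho>_def .
  qed simp
  have "(\<integral>\<^sup>+z. ennreal (indicator (ball 0 1) z * (1 - (norm z)\<^sup>2) powr (-\<gamma>)) \<partial>(lborel :: complex measure))
     \<le> (\<integral>\<^sup>+z. (\<Sum>n. ennreal (c n) * indicator (B n) z) \<partial>lborel)"
    by (rule nn_integral_mono) (rule pt)
  also have "\<dots> = (\<Sum>n. \<integral>\<^sup>+z. ennreal (c n) * indicator (B n) z \<partial>lborel)"
    using B_meas by (intro nn_integral_suminf) simp
  also have "\<dots> = (\<Sum>n. ennreal (c n * (pi * (1/2) ^ n)))"
    using B_meas c0 by (simp add: nn_integral_cmult_indicator B_em ennreal_mult)
  also have "\<dots> = ennreal (\<Sum>n. c n * (pi * (1/2) ^ n))"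
  proof (rule suminf_ennreal2)
    have "2 powr \<delta> < 2 powr 1" using \<delta> by (intro powr_less_mono) auto
    then have "summable (\<lambda>n. (2 powr \<delta> / 2) ^ n)" by (intro summable_geometric) simp
    then have "summable (\<lambda>n. (2 powr \<delta> * pi) * (2 powr \<delta> / 2) ^ n)" by (rule summable_mult)
    moreover have "(\<lambda>n. (2 powr \<delta> * pi) * (2 powr \<delta> / 2) ^ n) = (\<lambda>n. c n * (pi * (1/2) ^ n))"
      unfolding c_def by (simp add: power_divide fun_eq_iff)
    ultimately show "summable (\<lambda>n. c n * (pi * (1/2) ^ n))" by simp
  qed (use c0 in simp)
  also have "\<dots> < \<infinity>" by simp
  finally show ?thesis .
qed

lemma disc_density_measurable:
  assumes "h holomorphic_on ball 0 1" "continuous_on UNIV q"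
  shows "disc_density h q \<in> borel_measurable borel"
proof -
  have sq: "1 - (norm z)\<^sup>2 \<noteq> 0" "(1 - (norm z)\<^sup>2)\<^sup>2 \<noteq> 0" if "z \<in> ball 0 1" for z :: complex
  proof -
    have "(norm z)\<^sup>2 < 1" using that by (simp add: power_less_one_iff)
    then show "1 - (norm z)\<^sup>2 \<noteq> 0" "(1 - (norm z)\<^sup>2)\<^sup>2 \<noteq> 0" by auto
  qed
  have "continuous_on (ball 0 1) h" using assms(1) by (rule holomorphic_on_imp_continuous_on)
  then have "continuous_on (ball 0 1) (logheight h)" unfolding logheight_def
    by (intro continuous_intros ballI sq(1))
  then have "continuous_on (ball 0 1) (\<lambda>z. q (logheight h z))"
    by (rule continuous_on_compose2[OF assms(2)]) auto
  then have "continuous_on (ball 0 1) (\<lambda>z. q (logheight h z) / (1 - (norm z)\<^sup>2)\<^sup>2)"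
    by (intro continuous_intros ballI sq(2))
  then have "(\<lambda>z. indicator (ball 0 1) z *\<^sub>R (q (logheight h z) / (1 - (norm z)\<^sup>2)\<^sup>2)) \<in> borel_measurable borel"
    by (intro borel_measurable_continuous_on_indicator) auto
  moreover have "(\<lambda>z. indicator (ball 0 1) z *\<^sub>R (q (logheight h z) / (1 - (norm z)\<^sup>2)\<^sup>2)) = disc_density h q"
    by (auto simp: disc_density_def fun_eq_iff indicator_def)
  ultimately show ?thesis by simp
qed

lemma exp_logheight:
  assumes "norm z < 1"
  shows "exp (\<beta> * logheight h z) = exp (2 * \<beta> * Re (h z)) * (1 - (norm z)\<^sup>2) powr \<beta>"
proof -
  have "0 < 1 - (norm z)\<^sup>2" using assms by (simp add: power_less_one_iff)
  then show ?thesis by (simp add: logheight_def powr_def exp_add[symmetric] algebra_simps)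
qed

lemma integrable_exp_density:
  assumes hol: "h holomorphic_on ball 0 1" and bound: "\<And>z. norm z < 1 \<Longrightarrow> Re (h z) \<le> C"
    and \<beta>: "\<beta> > 1"
  shows "integrable lborel (disc_density h (\<lambda>t. exp (\<beta> * t)))"
proof -
  have meas: "disc_density h (\<lambda>t. exp (\<beta> * t)) \<in> borel_measurable borel"
    by (intro disc_density_measurable[OF hol] continuous_intros)
  define w where "w = (\<lambda>z::complex. indicator (ball 0 1) z * (1 - (norm z)\<^sup>2) powr (-(2 - \<beta>)))"
  have w_meas: "w \<in> borel_measurable borel"
  proof -
    have "continuous_on (ball 0 1) (\<lambda>z::complex. (1 - (norm z)\<^sup>2) powr (-(2 - \<beta>)))"
    proof (intro continuous_intros ballI)
      fix z :: complex assume "z \<in> ball 0 1"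
      then have "(norm z)\<^sup>2 < 1" by (simp add: power_less_one_iff)
      then show "1 - (norm z)\<^sup>2 \<noteq> 0" by simp
    qed
    then have "(\<lambda>z::complex. indicator (ball 0 1) z *\<^sub>R (1 - (norm z)\<^sup>2) powr (-(2 - \<beta>))) \<in> borel_measurable borel"
      by (rule borel_measurable_continuous_on_indicator[rotated]) simp
    then show ?thesis unfolding w_def real_scaleR_def .
  qed
  have w_int: "integrable lborel w"
  proof (rule integrableI_nonneg)
    show "(\<integral>\<^sup>+z. ennreal (w z) \<partial>lborel) < \<infinity>" unfolding w_def
      by (rule nn_integral_disc_weight) (use \<beta> in simp)
    show "AE z in lborel. 0 \<le> w z" by (simp add: w_def)
  qed (use w_meas in simp)
  show ?thesis
  proof (rule Bochner_Integration.integrable_bound[OF integrable_mult_right[OF w_int, of "exp (2 * \<beta> * C)"]])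
    show "AE z in lborel. norm (disc_density h (\<lambda>t. exp (\<beta> * t)) z) \<le> norm (exp (2 * \<beta> * C) * w z)"
    proof (rule AE_I2)
      fix z
      show "norm (disc_density h (\<lambda>t. exp (\<beta> * t)) z) \<le> norm (exp (2 * \<beta> * C) * w z)"
      proof (cases "norm z < 1")
        case True
        define \<rho> where "\<rho> = 1 - (norm z)\<^sup>2"
        have \<rho>: "0 < \<rho>" using True by (simp add: \<rho>_def power_less_one_iff)
        have p: "\<rho> powr \<beta> / \<rho>\<^sup>2 = \<rho> powr (-(2 - \<beta>))"
          using \<rho> by (simp add: powr_diff powr_numeral)
        have "disc_density h (\<lambda>t. exp (\<beta> * t)) z = exp (2 * \<beta> * Re (h z)) * (\<rho> powr \<beta> / \<rho>\<^sup>2)"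
          using True by (simp add: disc_density_def exp_logheight \<rho>_def)
        then have "disc_density h (\<lambda>t. exp (\<beta> * t)) z = exp (2 * \<beta> * Re (h z)) * \<rho> powr (-(2 - \<beta>))"
          unfolding p .
        moreover have "exp (2 * \<beta> * Re (h z)) \<le> exp (2 * \<beta> * C)"
          using bound[OF True] \<beta> by simp
        ultimately show ?thesis using True by (simp add: w_def \<rho>_def mult_right_mono)
      qed (simp add: disc_density_def)
    qed
  qed (use meas in simp)
qed

lemma integrable_density_dominated:
  assumes hol: "h holomorphic_on ball 0 1" and bound: "\<And>z. norm z < 1 \<Longrightarrow> Re (h z) \<le> C"
    and nonpos: "\<And>z. norm z < 1 \<Longrightarrow> logheight h z \<le> 0"
    and \<beta>: "\<beta> > 1" and q: "continuous_on UNIV q" "\<And>t. t \<le> 0 \<Longrightarrow> \<bar>q t\<bar> \<le> K * exp (\<beta> * t)"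
  shows "integrable lborel (disc_density h q)"
proof (rule Bochner_Integration.integrable_bound[OF integrable_mult_right[OF integrable_exp_density[OF hol bound \<beta>], of K]])
  show "AE z in lborel. norm (disc_density h q z) \<le> norm (K * disc_density h (\<lambda>t. exp (\<beta> * t)) z)"
  proof (rule AE_I2)
    fix z
    show "norm (disc_density h q z) \<le> norm (K * disc_density h (\<lambda>t. exp (\<beta> * t)) z)"
    proof (cases "norm z < 1")
      case True
      have "\<bar>q (logheight h z)\<bar> / (1 - (norm z)\<^sup>2)\<^sup>2 \<le> K * exp (\<beta> * logheight h z) / (1 - (norm z)\<^sup>2)\<^sup>2"
        using q(2)[OF nonpos[OF True]] by (intro divide_right_mono) auto
      then have "norm (disc_density h q z) \<le> K * disc_density h (\<lambda>t. exp (\<beta> * t)) z"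
        using True by (simp add: disc_density_def)
      then show ?thesis by simp
    qed (simp add: disc_density_def)
  qed
next
  show "disc_density h q \<in> borel_measurable lborel"
    unfolding measurable_lborel2 by (rule disc_density_measurable[OF hol q(1)])
qed

lemma abs_exp_le:
  fixes t :: real
  assumes "\<beta>' < \<beta>" "t \<le> 0"
  shows "\<bar>t\<bar> * exp (\<beta> * t) \<le> 1 / (\<beta> - \<beta>') * exp (\<beta>' * t)"
proof -
  have "(\<beta> - \<beta>') * \<bar>t\<bar> \<le> exp ((\<beta> - \<beta>') * \<bar>t\<bar>)"
    using exp_ge_add_one_self[of "(\<beta> - \<beta>') * \<bar>t\<bar>"] by linarith
  then have "(\<beta> - \<beta>') * \<bar>t\<bar> * exp (\<beta> * t) \<le> exp ((\<beta> - \<beta>') * \<bar>t\<bar>) * exp (\<beta> * t)"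
    by (intro mult_right_mono) auto
  also have "\<dots> = exp (\<beta>' * t)" using assms(2) by (simp add: exp_add[symmetric] algebra_simps)
  finally show ?thesis using assms(1) by (simp add: field_simps)
qed

text \<open>
  Passage to functions \<open>\<phi>\<close> without compact support. The weight \<open>\<phi>'\<close> is multiplied by cutoffs that vanish outside
  \<open>{-n..-1/n}\<close>: \<open>disc_superlevel_inequality\<close> needs a point strictly above the levels in use, and \<open>0\<close> is
  the largest level. Both sides converge by dominated convergence, since \<open>0 \<le> G n \<le> \<phi>\<close> on the
  negative half-line.
\<close>

lemma disc_inequality_up_to_maximum:
  assumes hol: "h holomorphic_on ball 0 1" and bound: "\<And>z. norm z < 1 \<Longrightarrow> Re (h z) \<le> C"
    and nonpos: "\<And>z. norm z < 1 \<Longrightarrow> logheight h z \<le> 0" and z0: "norm z0 < 1" "logheight h z0 = 0"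
    and \<phi>: "\<And>t. (\<phi> has_real_derivative \<phi>' t) (at t)" "continuous_on UNIV \<phi>'"
      "\<And>t. t \<le> 0 \<Longrightarrow> 0 \<le> \<phi>' t" "\<And>t. t \<le> 0 \<Longrightarrow> 0 \<le> \<phi> t" "(\<lambda>n. \<phi> (1 - real n)) \<longlonglongrightarrow> 0"
    and \<phi>'_zero: "\<phi>' 0 = 0"
    and int: "integrable lborel (disc_density h \<phi>)" "integrable lborel (disc_density h \<phi>')"
  shows "(LINT z|lborel. disc_density h \<phi>' z) \<ge> (LINT z|lborel. disc_density h \<phi> z) + pi * \<phi> 0"
proof -
  define cut where "cut = (\<lambda>n t. max 0 (min 1 (min (real n + t) (- real n * t - 1))))"
  define g where "g = (\<lambda>n t. \<phi>' t * cut n t)"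
  have cut_cont: "continuous_on UNIV (cut n)" for n unfolding cut_def by (intro continuous_intros)
  have g_cont: "continuous_on UNIV (g n)" for n unfolding g_def by (intro continuous_intros \<phi>(2) cut_cont)
  have cut01: "0 \<le> cut n t" "cut n t \<le> 1" for n t unfolding cut_def by auto
  have cut0: "cut n t = 0" if "t \<le> - real n \<or> - (1 / real n) \<le> t" "n \<ge> 1" for n t
  proof -
    have "real n + t \<le> 0 \<or> - real n * t - 1 \<le> 0" using that by (auto simp: field_simps)
    then show ?thesis unfolding cut_def by auto
  qed
  have cut1: "cut n t = 1" if "1 - real n \<le> t" "t \<le> - (2 / real n)" "n \<ge> 1" for n t
  proof -
    have "real n * t \<le> -2" using that by (simp add: field_simps)
    then show ?thesis unfolding cut_def using that by auto
  qed
  have g_nn: "0 \<le> g n t" if "n \<ge> 1" for n t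
  proof (cases "t \<le> 0")
    case False
    have "- (1 / real n) \<le> t" using False by (smt (verit) of_nat_0_le_iff zero_le_divide_1_iff)
    then show ?thesis using cut0[of t n] that by (simp add: g_def)
  qed (use \<phi>(3) cut01 in \<open>simp add: g_def\<close>)
  have g_le: "g n t \<le> \<phi>' t" if "t \<le> 0" for n t
    using mult_left_mono[OF cut01(2) \<phi>(3)[OF that]] by (simp add: g_def)
  have "\<forall>n. \<exists>F. \<forall>t. (F has_real_derivative g n t) (at t)" using antiderivative_real[OF g_cont] by metis
  then obtain G0 where G0: "\<And>n t. (G0 n has_real_derivative g n t) (at t)" by metis
  define G where "G = (\<lambda>n t. G0 n t - G0 n (- real n))"
  have G: "(G n has_real_derivative g n t) (at t)" for n t
    unfolding G_def using G0 by (auto intro!: derivative_eq_intros)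
  have Gc: "G n (- real n) = 0" for n unfolding G_def by simp
  have G_mono: "G n s \<le> G n t" if "s \<le> t" "n \<ge> 1" for n s t
    by (rule DERIV_nonneg_imp_nondecreasing[OF that(1)]) (use G g_nn that in blast)
  have G_low: "G n t = 0" if "t \<le> - real n" "n \<ge> 1" for n t
  proof -
    have i1: "(g n has_integral G n (- real n) - G n t) {t..- real n}" by (rule FTC_real[OF G that(1)])
    have i2: "(g n has_integral 0) {t..- real n}"
      by (rule has_integral_is_0) (use cut0 that in \<open>auto simp: g_def\<close>)
    show ?thesis using has_integral_unique[OF i1 i2] Gc by simp
  qed
  have G_nn: "0 \<le> G n t" if "n \<ge> 1" for n t
    using G_low[of t n] G_mono[of "- real n" t n] Gc that by (cases "t \<le> - real n") auto
  have G_le: "G n t \<le> \<phi> t" if "t \<le> 0" "n \<ge> 1" for n t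
  proof (cases "t \<le> - real n")
    case True
    then show ?thesis using G_low that \<phi>(4) by simp
  next
    case False
    have "\<phi> (- real n) - G n (- real n) \<le> \<phi> t - G n t"
    proof (rule DERIV_nonneg_imp_nondecreasing[of "- real n" t])
      show "\<exists>y. ((\<lambda>t. \<phi> t - G n t) has_real_derivative y) (at x) \<and> 0 \<le> y" if "x \<le> t" for x
        using that \<open>t \<le> 0\<close> g_le[of x n] by (intro exI[of _ "\<phi>' x - g n x"]) (auto intro!: DERIV_diff \<phi>(1) G)
    qed (use False in auto)
    then show ?thesis using \<phi>(4)[of "- real n"] Gc[of n] by simp
  qed
  have G_ge: "\<phi> (min t (- (2 / real n))) - \<phi> (1 - real n) \<le> G n t"
    if "1 - real n \<le> min t (- (2 / real n))" "n \<ge> 1" for n t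
  proof -
    let ?m = "min t (- (2 / real n))"
    have i1: "(g n has_integral G n ?m - G n (1 - real n)) {1 - real n..?m}" by (rule FTC_real[OF G that(1)])
    have i2: "(\<phi>' has_integral \<phi> ?m - \<phi> (1 - real n)) {1 - real n..?m}" by (rule FTC_real[OF \<phi>(1) that(1)])
    have "(g n has_integral \<phi> ?m - \<phi> (1 - real n)) {1 - real n..?m}"
      by (rule has_integral_eq[OF _ i2]) (use cut1 that in \<open>auto simp: g_def\<close>)
    from has_integral_unique[OF i1 this] have "\<phi> ?m - \<phi> (1 - real n) \<le> G n ?m"
      using G_nn[OF that(2), of "1 - real n"] by linarith
    also have "\<dots> \<le> G n t" by (rule G_mono) (use that in auto)
    finally show ?thesis .
  qed
  have cut_lim: "(\<lambda>n. cut n t) \<longlonglongrightarrow> 1" if "t < 0" for t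
  proof (rule tendsto_eventually)
    obtain N :: nat where N: "real N \<ge> max (1 - t) (2 / (- t))" using real_arch_simple by blast
    have "cut n t = 1" if "n \<ge> max N 1" for n
    proof (rule cut1)
      have n: "real n \<ge> 1 - t" "real n \<ge> 2 / (-t)" using N that by (auto intro: order_trans[OF _ iffD2[OF of_nat_le_iff]])
      show "1 - real n \<le> t" using n by simp
      have "2 \<le> real n * (-t)" using n(2) \<open>t < 0\<close> by (simp add: field_simps)
      then show "t \<le> - (2 / real n)" using that by (simp add: field_simps)
      show "n \<ge> 1" using that by simp
    qed
    then show "\<forall>\<^sub>F n in sequentially. cut n t = 1" using eventually_sequentially by blast
  qed
  have \<phi>_cont: "isCont \<phi> t" for t using \<phi>(1) DERIV_isCont by blast
  have \<phi>'0: "(\<lambda>n. g n t) \<longlonglongrightarrow> \<phi>' t" if "t < 0" for t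
    using tendsto_mult[OF tendsto_const cut_lim[OF that], of "\<phi>' t"] by (simp add: g_def)
  have G_lim: "(\<lambda>n. G n t) \<longlonglongrightarrow> \<phi> t" if t: "t \<le> 0" for t
  proof (rule tendsto_sandwich)
    have m: "(\<lambda>n. min t (- (2 / real n))) \<longlonglongrightarrow> min t (- 0)"
      by (intro tendsto_intros lim_const_over_n)
    then have "(\<lambda>n. \<phi> (min t (- (2 / real n)))) \<longlonglongrightarrow> \<phi> t"
      using t isCont_tendsto_compose[OF \<phi>_cont m] by (simp add: min_def)
    then have "(\<lambda>n. \<phi> (min t (- (2 / real n))) - \<phi> (1 - real n)) \<longlonglongrightarrow> \<phi> t - 0"
      by (intro tendsto_diff \<phi>(5))
    then show "(\<lambda>n. \<phi> (min t (- (2 / real n))) - \<phi> (1 - real n)) \<longlonglongrightarrow> \<phi> t" by simp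
    obtain N :: nat where N: "real N \<ge> max (1 - t) 3" using real_arch_simple by blast
    show "\<forall>\<^sub>F n in sequentially. \<phi> (min t (- (2 / real n))) - \<phi> (1 - real n) \<le> G n t"
      unfolding eventually_sequentially
    proof (intro exI[of _ N] allI impI)
      fix n assume "N \<le> n"
      then have n: "real n \<ge> 1 - t" "real n \<ge> 3" using N by (auto intro: order_trans[OF _ iffD2[OF of_nat_le_iff]])
      have "2 / real n \<le> 1" using n(2) by (simp add: divide_le_eq)
      then have "1 - real n \<le> - (2 / real n)" using n(2) by linarith
      then have "1 - real n \<le> min t (- (2 / real n))" using n(1) by (intro min.boundedI) linarith+
      then show "\<phi> (min t (- (2 / real n))) - \<phi> (1 - real n) \<le> G n t"
        using n(2) by (intro G_ge) auto
    qed
    show "\<forall>\<^sub>F n in sequentially. G n t \<le> \<phi> t"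
      unfolding eventually_sequentially using G_le[OF t] by blast
  qed simp
  have ineq: "integrable lborel (disc_density h (g n)) \<and> integrable lborel (disc_density h (G n)) \<and>
     (LINT z|lborel. disc_density h (g n) z) \<ge> (LINT z|lborel. disc_density h (G n) z) + pi * G n (- (1 / real n))"
    if n: "n \<ge> 2" for n
  proof -
    have n1: "n \<ge> 1" using n by simp
    have "1 / real n \<le> 1" "1 < real n" using n by auto
    then have 1: "- real n < - (1 / real n)" by linarith
    have s: "g n t = 0" if "t \<le> - real n \<or> - (1 / real n) \<le> t" for t using cut0[OF that n1] by (simp add: g_def)
    have t: "- (1 / real n) < logheight h z0" using z0 n by simp
    show ?thesis
      using disc_superlevel_inequality[OF hol bound g_cont g_nn[OF n1] s 1 z0(1) t G Gc] by blast
  qed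
  have dom: "norm (disc_density h q z) \<le> disc_density h \<psi> z" if "\<And>t. t \<le> 0 \<Longrightarrow> 0 \<le> q t \<and> q t \<le> \<psi> t" for q \<psi> z
  proof (cases "norm z < 1")
    case True
    then show ?thesis using that[OF nonpos[OF True]] by (simp add: disc_density_def divide_right_mono)
  qed (simp add: disc_density_def)
  have L1: "(\<lambda>n. LINT z|lborel. disc_density h (g (n + 2)) z) \<longlonglongrightarrow> (LINT z|lborel. disc_density h \<phi>' z)"
  proof (rule integral_dominated_convergence[OF _ _ int(2)])
    show "disc_density h \<phi>' \<in> borel_measurable lborel" using int(2) by (rule borel_measurable_integrable)
    show "disc_density h (g (n + 2)) \<in> borel_measurable lborel" for n
      using ineq[of "n + 2"] by (auto intro: borel_measurable_integrable)
    show "AE z in lborel. norm (disc_density h (g (n + 2)) z) \<le> disc_density h \<phi>' z" for n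
      by (intro AE_I2 dom) (use g_nn g_le in auto)
    show "AE z in lborel. (\<lambda>n. disc_density h (g (n + 2)) z) \<longlonglongrightarrow> disc_density h \<phi>' z"
    proof (rule AE_I2)
      fix z
      show "(\<lambda>n. disc_density h (g (n + 2)) z) \<longlonglongrightarrow> disc_density h \<phi>' z"
      proof (cases "norm z < 1")
        case True
        have "(\<lambda>n. g (n + 2) (logheight h z)) \<longlonglongrightarrow> \<phi>' (logheight h z)"
        proof (cases "logheight h z < 0")
          case False
          then have "logheight h z = 0" using nonpos[OF True] by simp
          moreover have "g n 0 = 0" for n using \<phi>'_zero by (simp add: g_def)
          ultimately show ?thesis using \<phi>'_zero by simp
        qed (rule LIMSEQ_ignore_initial_segment[OF \<phi>'0])
        then have "(\<lambda>n. g (n + 2) (logheight h z) / (1 - (norm z)\<^sup>2)\<^sup>2) \<longlonglongrightarrow> \<phi>' (logheight h z) / (1 - (norm z)\<^sup>2)\<^sup>2"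
          unfolding divide_inverse by (rule tendsto_mult_right)
        then show ?thesis using True by (simp add: disc_density_def)
      qed (simp add: disc_density_def)
    qed
  qed
  have L2: "(\<lambda>n. LINT z|lborel. disc_density h (G (n + 2)) z) \<longlonglongrightarrow> (LINT z|lborel. disc_density h \<phi> z)"
  proof (rule integral_dominated_convergence[OF _ _ int(1)])
    show "disc_density h \<phi> \<in> borel_measurable lborel" using int(1) by (rule borel_measurable_integrable)
    show "disc_density h (G (n + 2)) \<in> borel_measurable lborel" for n
      using ineq[of "n + 2"] by (auto intro: borel_measurable_integrable)
    show "AE z in lborel. norm (disc_density h (G (n + 2)) z) \<le> disc_density h \<phi> z" for n
      by (intro AE_I2 dom) (use G_nn G_le in auto)
    show "AE z in lborel. (\<lambda>n. disc_density h (G (n + 2)) z) \<longlonglongrightarrow> disc_density h \<phi> z"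
    proof (rule AE_I2)
      fix z
      show "(\<lambda>n. disc_density h (G (n + 2)) z) \<longlonglongrightarrow> disc_density h \<phi> z"
      proof (cases "norm z < 1")
        case True
        have "(\<lambda>n. G (n + 2) (logheight h z)) \<longlonglongrightarrow> \<phi> (logheight h z)"
          by (rule LIMSEQ_ignore_initial_segment[OF G_lim[OF nonpos[OF True]]])
        then have "(\<lambda>n. G (n + 2) (logheight h z) / (1 - (norm z)\<^sup>2)\<^sup>2) \<longlonglongrightarrow> \<phi> (logheight h z) / (1 - (norm z)\<^sup>2)\<^sup>2"
          unfolding divide_inverse by (rule tendsto_mult_right)
        then show ?thesis using True by (simp add: disc_density_def)
      qed (simp add: disc_density_def)
    qed
  qed
  have "(\<lambda>n. G (n + 2) 0) \<longlonglongrightarrow> \<phi> 0" by (rule LIMSEQ_ignore_initial_segment[OF G_lim]) simp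
  then have L3: "(\<lambda>n. (LINT z|lborel. disc_density h (G (n + 2)) z) + pi * G (n + 2) 0)
      \<longlonglongrightarrow> (LINT z|lborel. disc_density h \<phi> z) + pi * \<phi> 0"
    by (intro tendsto_add L2 tendsto_mult tendsto_const)
  have "(LINT z|lborel. disc_density h (G (n + 2)) z) + pi * G (n + 2) 0 \<le> (LINT z|lborel. disc_density h (g (n + 2)) z)" for n
  proof -
    let ?c = "- (1 / real (n + 2))"
    have c0: "?c \<le> 0" by simp
    have i1: "(g (n + 2) has_integral G (n + 2) 0 - G (n + 2) ?c) {?c..0}" by (rule FTC_real[OF G c0])
    have i2: "(g (n + 2) has_integral 0) {?c..0}"
      by (rule has_integral_is_0) (use cut0 in \<open>auto simp: g_def\<close>)
    have "G (n + 2) 0 = G (n + 2) ?c" using has_integral_unique[OF i1 i2] by simp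
    then show ?thesis using ineq[of "n + 2"] by simp
  qed
  then show ?thesis by (intro LIMSEQ_le[OF L3 L1]) blast
qed

section \<open>The derivative of the norm\<close>

lemma disc_density_linear:
  "disc_density h (\<lambda>t. a * p t + b * q t) z = a * disc_density h p z + b * disc_density h q z"
  by (simp add: disc_density_def add_divide_distrib)

lemma exp_diff_bound:
  fixes t :: real
  assumes "\<beta> \<le> x" "\<beta> \<le> y" "t \<le> 0"
  shows "\<bar>exp (y * t) - exp (x * t)\<bar> \<le> \<bar>y - x\<bar> * (\<bar>t\<bar> * exp (\<beta> * t))"
proof -
  have *: "exp a - exp b \<le> (a - b) * exp c" if "b \<le> a" "a \<le> c" for a b c :: real
  proof -
    have "exp a * (1 + (b - a)) \<le> exp a * exp (b - a)"
      by (intro mult_left_mono exp_ge_add_one_self) auto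
    then have "exp a - exp b \<le> (a - b) * exp a" by (simp add: exp_add[symmetric] algebra_simps)
    also have "\<dots> \<le> (a - b) * exp c" using that by (intro mult_left_mono) auto
    finally show ?thesis .
  qed
  have xy: "x * t \<le> \<beta> * t" "y * t \<le> \<beta> * t" using assms by (auto intro: mult_right_mono_neg)
  have ab: "\<bar>y * t - x * t\<bar> = \<bar>y - x\<bar> * \<bar>t\<bar>" by (simp add: abs_mult[symmetric] algebra_simps)
  have "\<bar>exp (y * t) - exp (x * t)\<bar> \<le> \<bar>y * t - x * t\<bar> * exp (\<beta> * t)"
  proof (cases "x * t \<le> y * t")
    case True
    then show ?thesis using *[OF True xy(2)] by simp
  next
    case False
    then have "y * t \<le> x * t" by simp
    then show ?thesis using *[OF _ xy(1)] by (simp add: abs_if)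
  qed
  then show ?thesis unfolding ab by (simp add: mult.assoc)
qed

context
  fixes h :: "complex \<Rightarrow> complex" and C \<alpha> :: real
  assumes hol: "h holomorphic_on ball 0 1" and bound: "\<And>z. norm z < 1 \<Longrightarrow> Re (h z) \<le> C"
    and nonpos: "\<And>z. norm z < 1 \<Longrightarrow> logheight h z \<le> 0" and \<alpha>: "\<alpha> > 1"
begin

lemma integrable_abs_exp_density:
  assumes "\<beta> > 1"
  shows "integrable lborel (disc_density h (\<lambda>t. \<bar>t\<bar> * exp (\<beta> * t)))"
proof (rule integrable_density_dominated[OF hol bound nonpos])
  show "1 < (1 + \<beta>) / 2" using assms by simp
  show "\<bar>\<bar>t\<bar> * exp (\<beta> * t)\<bar> \<le> 1 / (\<beta> - (1 + \<beta>) / 2) * exp ((1 + \<beta>) / 2 * t)" if "t \<le> 0" for t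
    using abs_exp_le[of "(1 + \<beta>) / 2" \<beta> t] assms that by (simp add: abs_mult)
qed (auto intro!: continuous_intros)

lemma integrable_linear_exp_density: "integrable lborel (disc_density h (\<lambda>t. t * exp (\<alpha> * t)))"
proof (rule integrable_density_dominated[OF hol bound nonpos])
  show "1 < (1 + \<alpha>) / 2" using \<alpha> by simp
  show "\<bar>t * exp (\<alpha> * t)\<bar> \<le> 1 / (\<alpha> - (1 + \<alpha>) / 2) * exp ((1 + \<alpha>) / 2 * t)" if "t \<le> 0" for t
    using abs_exp_le[of "(1 + \<alpha>) / 2" \<alpha> t] \<alpha> that by (simp add: abs_mult)
qed (auto intro!: continuous_intros)

text \<open>
  Differentiation under the integral sign. Difference quotients near \<open>\<alpha>\<close> are dominated by
  \<open>\<bar>t\<bar> exp (\<beta> t)\<close> for a fixed \<open>\<beta>\<close> between \<open>1\<close> and \<open>\<alpha>\<close>, because \<open>t = logheight h z\<close> is nonpositive.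
\<close>

lemma DERIV_exp_density_integral:
  "((\<lambda>\<beta>. LINT z|lborel. disc_density h (\<lambda>t. exp (\<beta> * t)) z) has_real_derivative
     (LINT z|lborel. disc_density h (\<lambda>t. t * exp (\<alpha> * t)) z)) (at \<alpha>)"
  unfolding has_field_derivative_iff tendsto_at_iff_sequentially
proof (intro allI impI)
  fix X :: "nat \<Rightarrow> real" assume X: "\<forall>i. X i \<in> UNIV - {\<alpha>}" "X \<longlonglongrightarrow> \<alpha>"
  let ?Q = "\<lambda>\<beta>. LINT z|lborel. disc_density h (\<lambda>t. exp (\<beta> * t)) z"
  define \<beta> where "\<beta> = (1 + \<alpha>) / 2"
  have \<beta>: "1 < \<beta>" "\<beta> < \<alpha>" using \<alpha> by (auto simp: \<beta>_def)
  obtain N where N: "\<And>i. i \<ge> N \<Longrightarrow> \<beta> < X i"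
    using order_tendstoD(1)[OF X(2) \<beta>(2)] by (auto simp: eventually_sequentially)
  define s where "s = (\<lambda>i. disc_density h (\<lambda>t. (exp (X (i + N) * t) - exp (\<alpha> * t)) / (X (i + N) - \<alpha>)))"
  have ne: "X i - \<alpha> \<noteq> 0" for i using X(1) by auto
  have s_eq: "s i z = (disc_density h (\<lambda>t. exp (X (i + N) * t)) z - disc_density h (\<lambda>t. exp (\<alpha> * t)) z) / (X (i + N) - \<alpha>)" for i z
    unfolding s_def by (simp add: disc_density_def diff_divide_distrib mult.commute)
  have int: "integrable lborel (disc_density h (\<lambda>t. exp (y * t)))" if "y > 1" for y
    by (rule integrable_exp_density[OF hol bound that])
  have intX: "integrable lborel (disc_density h (\<lambda>t. exp (X (i + N) * t)))" for i
    by (rule int) (use N[of "i + N"] \<beta> in simp)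
  have s_int: "(LINT z|lborel. s i z) = (?Q (X (i + N)) - ?Q \<alpha>) / (X (i + N) - \<alpha>)" for i
    unfolding s_eq by (simp add: Bochner_Integration.integral_diff intX int[OF \<alpha>])
  have "(\<lambda>i. LINT z|lborel. s i z) \<longlonglongrightarrow> (LINT z|lborel. disc_density h (\<lambda>t. t * exp (\<alpha> * t)) z)"
  proof (rule integral_dominated_convergence[OF _ _ integrable_abs_exp_density[OF \<beta>(1)]])
    show "disc_density h (\<lambda>t. t * exp (\<alpha> * t)) \<in> borel_measurable lborel"
      by (rule borel_measurable_integrable[OF integrable_linear_exp_density])
    show "s i \<in> borel_measurable lborel" for i
    proof -
      have "integrable lborel (s i)" unfolding s_eq
        by (intro integrable_divide Bochner_Integration.integrable_diff intX int[OF \<alpha>])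
      then show ?thesis by (rule borel_measurable_integrable)
    qed
    show "AE z in lborel. norm (s i z) \<le> disc_density h (\<lambda>t. \<bar>t\<bar> * exp (\<beta> * t)) z" for i
    proof (rule AE_I2)
      fix z
      show "norm (s i z) \<le> disc_density h (\<lambda>t. \<bar>t\<bar> * exp (\<beta> * t)) z"
      proof (cases "norm z < 1")
        case True
        let ?t = "logheight h z" and ?d = "X (i + N) - \<alpha>"
        have "\<bar>exp (X (i + N) * ?t) - exp (\<alpha> * ?t)\<bar> \<le> \<bar>?d\<bar> * (\<bar>?t\<bar> * exp (\<beta> * ?t))"
          using N[of "i + N"] \<beta> nonpos[OF True] by (intro exp_diff_bound) auto
        then have "\<bar>exp (X (i + N) * ?t) - exp (\<alpha> * ?t)\<bar> / \<bar>?d\<bar> \<le> \<bar>?t\<bar> * exp (\<beta> * ?t)"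
          using ne[of "i + N"] by (simp add: divide_le_eq mult.commute)
        then have "\<bar>(exp (X (i + N) * ?t) - exp (\<alpha> * ?t)) / ?d\<bar> / (1 - (norm z)\<^sup>2)\<^sup>2
            \<le> \<bar>?t\<bar> * exp (\<beta> * ?t) / (1 - (norm z)\<^sup>2)\<^sup>2"
          by (intro divide_right_mono) (auto simp: abs_divide)
        then show ?thesis using True by (simp add: s_def disc_density_def abs_mult)
      qed (simp add: s_def disc_density_def)
    qed
    show "AE z in lborel. (\<lambda>i. s i z) \<longlonglongrightarrow> disc_density h (\<lambda>t. t * exp (\<alpha> * t)) z"
    proof (rule AE_I2)
      fix z
      have "((\<lambda>y. exp (y * logheight h z)) has_real_derivative logheight h z * exp (\<alpha> * logheight h z)) (at \<alpha>)"
        by (auto intro!: derivative_eq_intros)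
      then have "(\<lambda>i. (exp (X i * logheight h z) - exp (\<alpha> * logheight h z)) / (X i - \<alpha>))
          \<longlonglongrightarrow> logheight h z * exp (\<alpha> * logheight h z)"
        unfolding has_field_derivative_iff tendsto_at_iff_sequentially using X by (simp add: o_def)
      from LIMSEQ_ignore_initial_segment[OF this, of N]
      have "(\<lambda>i. (exp (X (i + N) * logheight h z) - exp (\<alpha> * logheight h z)) / (X (i + N) - \<alpha>) * inverse ((1 - (norm z)\<^sup>2)\<^sup>2))
          \<longlonglongrightarrow> logheight h z * exp (\<alpha> * logheight h z) * inverse ((1 - (norm z)\<^sup>2)\<^sup>2)"
        by (rule tendsto_mult_right)
      then show "(\<lambda>i. s i z) \<longlonglongrightarrow> disc_density h (\<lambda>t. t * exp (\<alpha> * t)) z"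
        by (simp add: s_def disc_density_def inverse_eq_divide)
    qed
  qed
  then have "(\<lambda>i. (?Q (X (i + N)) - ?Q \<alpha>) / (X (i + N) - \<alpha>)) \<longlonglongrightarrow> (LINT z|lborel. disc_density h (\<lambda>t. t * exp (\<alpha> * t)) z)"
    unfolding s_int .
  then show "((\<lambda>y. (?Q y - ?Q \<alpha>) / (y - \<alpha>)) \<circ> X) \<longlonglongrightarrow> (LINT z|lborel. disc_density h (\<lambda>t. t * exp (\<alpha> * t)) z)"
    unfolding o_def by (rule LIMSEQ_offset)
qed

text \<open>
  The function \<open>\<phi>\<close> is chosen such that \<open>\<phi>' - \<phi>\<close> is \<open>- exp (\<alpha> t) (1 + \<alpha> (\<alpha> - 1) t)\<close>, \<open>\<phi> 0 = 1\<close>, and \<open>\<phi>\<close> increases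
  up to its maximum at \<open>0\<close>.
\<close>

lemma entropy_inequality:
  assumes z0: "norm z0 < 1" "logheight h z0 = 0"
  shows "\<alpha> * (\<alpha> - 1) * (LINT z|lborel. disc_density h (\<lambda>t. t * exp (\<alpha> * t)) z)
     + (LINT z|lborel. disc_density h (\<lambda>t. exp (\<alpha> * t)) z) + pi \<le> 0"
proof -
  let ?Q = "LINT z|lborel. disc_density h (\<lambda>t. exp (\<alpha> * t)) z"
  let ?Q1 = "LINT z|lborel. disc_density h (\<lambda>t. t * exp (\<alpha> * t)) z"
  note int0 = integrable_exp_density[OF hol bound \<alpha>] and int1 = integrable_linear_exp_density
  define \<phi> where "\<phi> = (\<lambda>t. 1 * exp (\<alpha> * t) + (-\<alpha>) * (t * exp (\<alpha> * t)))"
  define \<phi>' where "\<phi>' = (\<lambda>t. (-(\<alpha>\<^sup>2)) * (t * exp (\<alpha> * t)) + 0 * exp (\<alpha> * t))"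
  have \<phi>_eq: "\<phi> t = (1 - \<alpha> * t) * exp (\<alpha> * t)" for t unfolding \<phi>_def by (simp add: algebra_simps)
  have \<phi>_int: "integrable lborel (disc_density h \<phi>)" "(LINT z|lborel. disc_density h \<phi> z) = ?Q - \<alpha> * ?Q1"
    unfolding \<phi>_def disc_density_linear using int0 int1 by auto
  have \<phi>'_int: "integrable lborel (disc_density h \<phi>')" "(LINT z|lborel. disc_density h \<phi>' z) = - (\<alpha>\<^sup>2) * ?Q1"
    unfolding \<phi>'_def disc_density_linear using int0 int1 by auto
  have lim: "(\<lambda>n. \<phi> (1 - real n)) \<longlonglongrightarrow> 0"
  proof -
    have "((\<lambda>s::real. s ^ 0 / exp s + s ^ 1 / exp s) \<longlongrightarrow> 0 + 0) at_top"
      by (intro tendsto_add tendsto_power_div_exp_0)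
    moreover have "filterlim (\<lambda>n. \<alpha> * (real n - 1)) at_top sequentially"
    proof (rule filterlim_tendsto_pos_mult_at_top[OF tendsto_const])
      have "filterlim (\<lambda>n. - 1 + real n) at_top sequentially"
        by (intro filterlim_tendsto_add_at_top[OF tendsto_const] filterlim_real_sequentially)
      then show "filterlim (\<lambda>n. real n - 1) at_top sequentially" by simp
    qed (use \<alpha> in simp)
    ultimately have "(\<lambda>n. (\<lambda>s::real. s ^ 0 / exp s + s ^ 1 / exp s) (\<alpha> * (real n - 1))) \<longlonglongrightarrow> 0 + 0"
      by (rule filterlim_compose)
    moreover have "(\<lambda>s::real. s ^ 0 / exp s + s ^ 1 / exp s) (\<alpha> * (real n - 1)) = \<phi> (1 - real n)" for n
    proof -
      have "\<alpha> * (1 - real n) = - (\<alpha> * (real n - 1))" by (simp add: algebra_simps)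
      then show ?thesis unfolding \<phi>_eq by (simp add: exp_minus divide_inverse distrib_right)
    qed
    ultimately show ?thesis by simp
  qed
  have "(LINT z|lborel. disc_density h \<phi>' z) \<ge> (LINT z|lborel. disc_density h \<phi> z) + pi * \<phi> 0"
  proof (rule disc_inequality_up_to_maximum[OF hol bound nonpos z0 _ _ _ _ lim _ \<phi>_int(1) \<phi>'_int(1)])
    show "(\<phi> has_real_derivative \<phi>' t) (at t)" for t
      unfolding \<phi>_def \<phi>'_def by (auto intro!: derivative_eq_intros simp: power2_eq_square algebra_simps)
    show "continuous_on UNIV \<phi>'" unfolding \<phi>'_def by (intro continuous_intros)
    show "0 \<le> \<phi>' t" if "t \<le> 0" for t
      using that by (simp add: \<phi>'_def mult_nonneg_nonpos mult_nonpos_nonneg)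
    show "0 \<le> \<phi> t" if "t \<le> 0" for t
      using that \<alpha> mult_nonneg_nonpos[of \<alpha> t] unfolding \<phi>_eq by (intro mult_nonneg_nonneg) auto
    show "\<phi>' 0 = 0" by (simp add: \<phi>'_def)
  qed
  then show ?thesis unfolding \<phi>_int(2) \<phi>'_int(2) by (simp add: \<phi>_eq power2_eq_square algebra_simps)
qed

lemma exp_density_integral_pos: "(LINT z|lborel. disc_density h (\<lambda>t. exp (\<alpha> * t)) z) > 0"
proof -
  let ?q = "disc_density h (\<lambda>t. exp (\<alpha> * t))"
  note int = integrable_exp_density[OF hol bound \<alpha>]
  have nn: "0 \<le> ?q z" for z by (simp add: disc_density_def)
  have "(LINT z|lborel. ?q z) \<noteq> 0"
  proof
    assume "(LINT z|lborel. ?q z) = 0"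
    then have "AE z in lborel. ?q z = 0"
      using integral_nonneg_eq_0_iff_AE[OF int] nn by simp
    then have "AE z in lborel. z \<notin> ball (0::complex) 1"
    proof (rule AE_mp[OF _ AE_I2[OF impI]])
      fix z assume "?q z = 0"
      show "z \<notin> ball 0 1"
      proof
        assume "z \<in> ball 0 1"
        then have "norm z < 1" "(norm z)\<^sup>2 < 1" by (auto simp: power_less_one_iff)
        then show False using \<open>?q z = 0\<close> by (simp add: disc_density_def)
      qed
    qed
    then have "emeasure lborel (ball (0::complex) 1) = 0"
      by (subst (asm) AE_iff_measurable[of "ball 0 1"]) auto
    then show False by (simp add: emeasure_ball unit_ball_vol_2)
  qed
  moreover have "0 \<le> (LINT z|lborel. ?q z)" by (intro Bochner_Integration.integral_nonneg nn)
  ultimately show ?thesis by simp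
qed

end

theorem theorem2p7:
  fixes f h :: "complex \<Rightarrow> complex" and \<alpha> :: real and k :: nat
    and c :: "nat \<Rightarrow> real" and w :: "nat \<Rightarrow> complex"
  assumes "f \<in> zero_free_hol"
    and "\<alpha> > 1"
    and "disc_log f h"
    and "\<And>i. i \<in> {1..k} \<Longrightarrow> w i \<in> ball 0 1"
    and "\<And>z. z \<in> ball 0 1 \<Longrightarrow>
           exp (of_real \<alpha> * h z) =
             (\<Sum>i=1..k. of_real (c i) * (1 / (1 - cnj (w i) * z) powr of_real \<alpha>))"
    and "collinear (w ` {1..k})"
    and "\<And>i. i \<in> {1..k} \<Longrightarrow> c i \<ge> 0"
  shows "bergman_N f differentiable (at \<alpha>) \<and> deriv (bergman_N f) \<alpha> \<le> 0"
proof -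
  obtain U where U: "open U" "cball 0 1 \<subseteq> U" "f holomorphic_on U" and nz: "\<And>z. z \<in> cball 0 1 \<Longrightarrow> f z \<noteq> 0"
    using assms(1) unfolding zero_free_hol_def by blast
  have h_hol: "h holomorphic_on ball 0 1" and h_exp: "\<And>z. norm z < 1 \<Longrightarrow> f z = exp (h z)"
    using assms(3) unfolding disc_log_def by auto
  have f_cont: "continuous_on (cball 0 1) f"
    using holomorphic_on_imp_continuous_on[OF U(3)] U(2) continuous_on_subset by blast
  define u where "u = (\<lambda>z. (norm (f z))\<^sup>2 * (1 - (norm z)\<^sup>2))"
  have "continuous_on (cball 0 1) u" unfolding u_def by (intro continuous_intros f_cont)
  then obtain z0 where z0: "z0 \<in> cball 0 1" "\<And>z. z \<in> cball 0 1 \<Longrightarrow> u z \<le> u z0"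
    using continuous_attains_sup[OF compact_cball, of 0 1 u] by auto
  have "u 0 > 0" using nz[of 0] by (simp add: u_def)
  then have u0: "u z0 > 0" using z0(2)[of 0] by simp
  have z0_lt: "norm z0 < 1"
  proof (rule ccontr)
    assume "\<not> norm z0 < 1"
    then have "norm z0 = 1" using z0(1) by simp
    then show False using u0 by (simp add: u_def)
  qed
  \<comment> \<open>subtracting \<open>m / 2\<close> from \<open>h\<close> makes the maximum of the logarithm of the height equal to 0\<close>
  define m where "m = ln (u z0)"
  obtain B where B: "\<And>z. z \<in> cball 0 1 \<Longrightarrow> norm (f z) \<le> B"
    using compact_imp_bounded[OF compact_continuous_image[OF f_cont compact_cball]] unfolding bounded_iff by blast
  define h0 where "h0 = (\<lambda>z. h z - of_real (m / 2))"
  have hol: "h0 holomorphic_on ball 0 1" unfolding h0_def by (intro holomorphic_intros h_hol)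
  have fnorm: "norm (f z) = exp (Re (h z))" if "norm z < 1" for z using h_exp[OF that] by simp
  have bound: "Re (h0 z) \<le> ln B - m / 2" if "norm z < 1" for z
  proof -
    have "exp (Re (h z)) \<le> B" using B[of z] that fnorm[OF that] by simp
    then have "Re (h z) \<le> ln B" by (metis exp_gt_zero ln_exp ln_le_cancel_iff order_less_le_trans)
    then show ?thesis by (simp add: h0_def)
  qed
  have lh: "logheight h0 z = ln (u z) - m" and upos: "u z > 0" if "norm z < 1" for z
  proof -
    have \<rho>: "1 - (norm z)\<^sup>2 > 0" using that by (simp add: power_less_one_iff)
    show "u z > 0" unfolding u_def fnorm[OF that] using \<rho> by simp
    show "logheight h0 z = ln (u z) - m"
      unfolding u_def fnorm[OF that] logheight_def h0_def using \<rho>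
      by (simp add: ln_mult ln_realpow)
  qed
  have nonpos: "logheight h0 z \<le> 0" if "norm z < 1" for z
    unfolding lh[OF that] m_def using upos[OF that] u0 z0(2)[of z] that by simp
  have lh0: "logheight h0 z0 = 0" unfolding lh[OF z0_lt] m_def by simp
  define Q where "Q = (\<lambda>\<beta>. LINT z|lborel. disc_density h0 (\<lambda>t. exp (\<beta> * t)) z)"
  define Q1 where "Q1 = (LINT z|lborel. disc_density h0 (\<lambda>t. t * exp (\<alpha> * t)) z)"
  have dQ: "(Q has_real_derivative Q1) (at \<alpha>)"
    unfolding Q_def Q1_def by (rule DERIV_exp_density_integral[OF hol bound nonpos assms(2)])
  have ent: "\<alpha> * (\<alpha> - 1) * Q1 + Q \<alpha> + pi \<le> 0"
    unfolding Q_def Q1_def by (rule entropy_inequality[OF hol bound nonpos assms(2) z0_lt lh0])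
  have Qpos: "Q \<alpha> > 0"
    unfolding Q_def by (rule exp_density_integral_pos[OF hol bound nonpos assms(2)])
  define I where "I = (\<lambda>\<beta>. (\<beta> - 1) * exp (\<beta> * m) / pi * Q \<beta>)"
  have N_eq: "bergman_N f = (\<lambda>\<beta>. I \<beta> powr (1 / (2 * \<beta>)))"
  proof
    fix \<beta>
    have E: "indicator (ball 0 1) z *\<^sub>R (norm (f z) powr (2 * \<beta>) * (\<beta> - 1) * (1 - (norm z)\<^sup>2) powr (\<beta> - 2) / pi)
        = (\<beta> - 1) * exp (\<beta> * m) / pi * disc_density h0 (\<lambda>t. exp (\<beta> * t)) z" for z
    proof (cases "norm z < 1")
      case True
      define \<rho> where "\<rho> = 1 - (norm z)\<^sup>2"
      have \<rho>: "\<rho> > 0" using True by (simp add: \<rho>_def power_less_one_iff)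
      have "disc_density h0 (\<lambda>t. exp (\<beta> * t)) z = exp (2 * \<beta> * Re (h0 z)) * (\<rho> powr \<beta> / \<rho>\<^sup>2)"
        using True by (simp add: disc_density_def exp_logheight \<rho>_def)
      also have "\<rho> powr \<beta> / \<rho>\<^sup>2 = \<rho> powr (\<beta> - 2)" using \<rho> by (simp add: powr_diff powr_numeral)
      finally have d: "disc_density h0 (\<lambda>t. exp (\<beta> * t)) z = exp (2 * \<beta> * Re (h0 z)) * \<rho> powr (\<beta> - 2)" by simp
      have e: "exp (\<beta> * m) * exp (2 * \<beta> * Re (h0 z)) = norm (f z) powr (2 * \<beta>)"
        unfolding fnorm[OF True] by (simp add: powr_def h0_def exp_add[symmetric] algebra_simps)
      show ?thesis unfolding d e[symmetric] \<rho>_def[symmetric] using True by simp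
    qed (simp add: disc_density_def)
    show "bergman_N f \<beta> = I \<beta> powr (1 / (2 * \<beta>))"
      unfolding bergman_N_def set_lebesgue_integral_def E I_def Q_def
      by (simp only: Bochner_Integration.integral_mult_right_zero)
  qed
  \<comment> \<open>\<open>J\<close> is the normalised integral at \<open>\<alpha>\<close> and \<open>J1\<close> its derivative in \<open>\<alpha>\<close>\<close>
  define J J1 where "J = (\<alpha> - 1) * Q \<alpha> / pi" and "J1 = (Q \<alpha> + (\<alpha> - 1) * Q1) / pi"
  have J: "J > 0" unfolding J_def using Qpos assms(2) by simp
  have I_eq: "I \<alpha> = exp (\<alpha> * m) * J" unfolding I_def J_def by simp
  have Ipos: "I \<alpha> > 0" unfolding I_eq using J by simp
  have dI: "(I has_real_derivative exp (\<alpha> * m) * (J1 + m * J)) (at \<alpha>)"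
  proof -
    have "((\<lambda>\<beta>. (\<beta> - 1) * exp (\<beta> * m) / pi) has_real_derivative (exp (\<alpha> * m) + (\<alpha> - 1) * (m * exp (\<alpha> * m))) / pi) (at \<alpha>)"
      by (auto intro!: derivative_eq_intros)
    from DERIV_mult[OF this dQ] show ?thesis unfolding I_def J1_def J_def
      by (simp add: algebra_simps add_divide_distrib diff_divide_distrib)
  qed
  have dr: "((\<lambda>\<beta>. 1 / (2 * \<beta>)) has_real_derivative - (1 / (2 * \<alpha>\<^sup>2))) (at \<alpha>)"
    using assms(2) by (auto intro!: derivative_eq_intros simp: power2_eq_square field_simps)
  define D where "D = I \<alpha> powr (1 / (2 * \<alpha>)) *
      (- (1 / (2 * \<alpha>\<^sup>2)) * ln (I \<alpha>) + exp (\<alpha> * m) * (J1 + m * J) * (1 / (2 * \<alpha>)) / I \<alpha>)"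
  have dN: "(bergman_N f has_real_derivative D) (at \<alpha>)"
    unfolding N_eq D_def by (rule DERIV_powr[OF dI Ipos dr])
  have "\<alpha> * J1 - J = (\<alpha> * (\<alpha> - 1) * Q1 + Q \<alpha>) / pi"
    unfolding J1_def J_def by (simp add: diff_divide_distrib[symmetric] algebra_simps)
  also have "\<dots> \<le> - 1" using ent by (simp add: divide_le_eq)
  finally have J1_le: "\<alpha> * J1 \<le> J - 1" by simp
  have "ln (1 / J) \<le> 1 / J - 1" using J by (intro ln_le_minus_one) simp
  then have "1 - 1 / J \<le> ln J" using J by (simp add: ln_div)
  then have "J * (1 - 1 / J) \<le> J * ln J" using J by (intro mult_left_mono) auto
  then have "J - 1 \<le> J * ln J" using J by (simp add: algebra_simps)
  then have key: "\<alpha> * J1 - J * ln J \<le> 0" using J1_le by linarith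
  have "- (1 / (2 * \<alpha>\<^sup>2)) * ln (I \<alpha>) + exp (\<alpha> * m) * (J1 + m * J) * (1 / (2 * \<alpha>)) / I \<alpha>
      = (\<alpha> * J1 - J * ln J) / (2 * \<alpha>\<^sup>2 * J)"
  proof -
    have l: "ln (I \<alpha>) = \<alpha> * m + ln J" unfolding I_eq using J by (simp add: ln_mult)
    have q: "exp (\<alpha> * m) * (J1 + m * J) * (1 / (2 * \<alpha>)) / I \<alpha> = (J1 + m * J) / (2 * \<alpha> * J)"
      unfolding I_eq by simp
    show ?thesis unfolding l q using J assms(2) by (simp add: field_simps power2_eq_square)
  qed
  also have "\<dots> \<le> 0" using key J assms(2) by (intro divide_nonpos_pos) auto
  finally have "D \<le> 0" unfolding D_def by (intro mult_nonneg_nonpos) auto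
  moreover have "bergman_N f differentiable (at \<alpha>)"
    using dN unfolding has_field_derivative_def by (rule differentiableI)
  moreover have "deriv (bergman_N f) \<alpha> = D" by (rule DERIV_imp_deriv[OF dN])
  ultimately show ?thesis by simp
qed

end
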